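(* Let $f,g\in L^2(\mathbb R^2,\mathbb H)$. Then $$\left\|\mathcal W^{A_1,A_2}_{f,g}\right\|_{2,Q}=|f|_{2,Q}^2\,|g|_{2,Q}^2 .$$
   Context: $\mathbb H$ is the skew field of real quaternions with conjugation $q\mapsto\overline q$ and modulus $|q|_Q=\sqrt{q\overline q}$. $\lambda,\mu\in\mathbb H$ are pure unit quaternions, i.e. $\lambda^2=\mu^2=-1$, and $e^{\lambda\theta}=\cos\theta+\lambda\sin\theta$ for $\theta\in\mathbb R$. For $f:\mathbb R^2\to\mathbb H$, $|f|_{2,Q}=\left(\int_{\mathbb R^2}|f(t)|_Q^2\,dt\right)^{1/2}$, and $L^2(\mathbb R^2,\mathbb H)$ is the space of $f$ with $|f|_{2,Q}<\infty$; $\overline g$ denotes the function $x\mapsto\overline{g(x)}$. For $l=1,2$, $A_l$ stands for the real parameters $(a_l,b_l,c_l,d_l,\tau_l,\eta_l)$ with $a_ld_l-b_lc_l=1$. For $b_l\neq0$ and $\nu\in\{\lambda,\mu\}$ the kernel is $$K^{\nu}_{A_l}(x,y)=\frac{1}{\sqrt{\nu 2\pi b_l}}\exp\!\Big(\frac{\nu}{2b_l}\big(a_lx^2-2x(y-\tau_l)-2y(d_l\tau_l-b_l\eta_l)+d_l(y^2+\tau_l^2)\big)\Big),\qquad x,y\in\mathbb R,$$ with $\frac1{\sqrt\nu}=e^{-\nu\pi/4}$. Put $E^\nu_l(y)=e^{\nu\left(\frac{c_ld_l}{2}(y-\tau_l)^2+y\tau_l\right)}$ and $h_{f,g}(t,s)=f(t+\frac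 s2)\overline{g}(t-\frac s2)$ for $t,s\in\mathbb R^2$. The Wigner-Ville distribution associated with the two-sided quaternionic offset linear canonical transform (WVD-QOLCT) is $$\mathcal W^{A_1,A_2}_{f,g}(t,u)=\begin{cases}\displaystyle\int_{\mathbb R^2}K^{\lambda}_{A_1}(s_1,u_1)\,h_{f,g}(t,s)\,K^{\mu}_{A_2}(s_2,u_2)\,ds, & b_1,b_2\neq0,\\[2mm] \sqrt{d_1}\,E^\lambda_1(u_1)\,h_{f,g}\big(t,(d_1(u_1-\tau_1),s_2)\big)\,K^{\mu}_{A_2}(s_2,u_2),& b_1=0,\ b_2\neq0,\\[2mm] \sqrt{d_2}\,K^{\lambda}_{A_1}(s_1,u_1)\,h_{f,g}\big(t,(s_1,d_2(u_2-\tau_2))\big)\,E^\mu_2(u_2),& b_1\neq0,\ b_2=0,\\[2mm] \sqrt{d_1d_2}\,E^\lambda_1(u_1)\,h_{f,g}\big(t,(d_1(u_1-\tau_1),d_2(u_2-\tau_2))\big)\,E^\mu_2(u_2),& b_1=b_2=0\end{cases}$$ (the second and third cases are printed in this form, with no integration sign in the remaining variable). Equivalently, $\mathcal W^{A_1,A_2}_{f,g}(t,u)=\mathcal O^{\lambda,\mu}_{A_1,A_2}\{h_{f,g}(t,\cdot)\}(u)$, where $\mathcal O^{\lambda,\mu}_{A_1,A_2}$ is the two-sided quaternionic offset linear canonical transform (QOLCT), given by the same formulas with a function $h(s)$ in place of $h_{f,g}(t,s)$. The norm $\|\cdot\|$ is taken component-wise: writing $h=h_0+ih_1+jh_2+kh_3$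 with real-valued $h_m$, $\|\mathcal O^{\lambda,\mu}_{A_1,A_2}\{h\}(u)\|_Q=\big(\sum_{m=0}^3|\mathcal O^{\lambda,\mu}_{A_1,A_2}\{h_m\}(u)|_Q^2\big)^{1/2}$, and accordingly $\|\mathcal W^{A_1,A_2}_{f,g}(t,u)\|_Q$ is this quantity for $h=h_{f,g}(t,\cdot)$, with $$\|\mathcal W^{A_1,A_2}_{f,g}\|_{2,Q}=\Big(\int_{\mathbb R^2}\int_{\mathbb R^2}\|\mathcal W^{A_1,A_2}_{f,g}(t,u)\|_Q^2\,du\,dt\Big)^{1/2}.$$
   Formalization: The printed identity fails under f→2f; what is proved has the left-hand norm squared: ‖W‖² = |f|²|g|². When exactly one b_l is 0, the free variable is integrated over ℝ; square roots of negative numbers are principal roots in ℝ+νℝ. *)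

theory Defs
  imports "HOL-Analysis.Analysis"
begin

datatype quat = Quat (qRe: real) (qI: real) (qJ: real) (qK: real)

lemma quat_eq_iff:
  "x = y \<longleftrightarrow> qRe x = qRe y \<and> qI x = qI y \<and> qJ x = qJ y \<and> qK x = qK y"
  by (cases x; cases y) simp

instantiation quat :: real_vector
begin

definition "0 = Quat 0 0 0 0"
definition "x + y = Quat (qRe x + qRe y) (qI x + qI y) (qJ x + qJ y) (qK x + qK y)"
definition "- x = Quat (- qRe x) (- qI x) (- qJ x) (- qK x)"
definition "x - (y::quat) = x + - y"
definition "r *\<^sub>R x = Quat (r * qRe x) (r * qI x) (r * qJ x) (r * qK x)"

instance
proof
  fix x y z :: quat and r t :: real
  show "x + y + z = x + (y + z)" by (simp add: plus_quat_def)
  show "x + y = y + x" by (simp add: plus_quat_def add.commute)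
  show "0 + x = x" by (simp add: plus_quat_def zero_quat_def)
  show "- x + x = 0" by (simp add: plus_quat_def zero_quat_def uminus_quat_def)
  show "x - y = x + - y" by (rule minus_quat_def)
  show "r *\<^sub>R (x + y) = r *\<^sub>R x + r *\<^sub>R y" "(r + t) *\<^sub>R x = r *\<^sub>R x + t *\<^sub>R x"
    by (simp_all add: plus_quat_def scaleR_quat_def distrib_left distrib_right)
  show "r *\<^sub>R t *\<^sub>R x = (r * t) *\<^sub>R x" "1 *\<^sub>R x = x"
    by (simp_all add: scaleR_quat_def)
qed

end

lemma quat_sel_zero [simp]: "qRe 0 = 0" "qI 0 = 0" "qJ 0 = 0" "qK 0 = 0"
  by (simp_all add: zero_quat_def)

lemma quat_sel_plus [simp]:
  "qRe (x + y) = qRe x + qRe y" "qI (x + y) = qI x + qI y"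
  "qJ (x + y) = qJ x + qJ y" "qK (x + y) = qK x + qK y"
  by (simp_all add: plus_quat_def)

lemma quat_sel_uminus [simp]:
  "qRe (- x) = - qRe x" "qI (- x) = - qI x" "qJ (- x) = - qJ x" "qK (- x) = - qK x"
  by (simp_all add: uminus_quat_def)

lemma quat_sel_minus [simp]:
  "qRe (x - y) = qRe x - qRe y" "qI (x - y) = qI x - qI y"
  "qJ (x - y) = qJ x - qJ y" "qK (x - y) = qK x - qK y"
  by (simp_all add: minus_quat_def del: add_uminus_conv_diff)

lemma quat_sel_scaleR [simp]:
  "qRe (r *\<^sub>R x) = r * qRe x" "qI (r *\<^sub>R x) = r * qI x"
  "qJ (r *\<^sub>R x) = r * qJ x" "qK (r *\<^sub>R x) = r * qK x"
  by (simp_all add: scaleR_quat_def)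

instantiation quat :: real_div_algebra
begin

definition "1 = Quat 1 0 0 0"

definition "x * y = Quat
  (qRe x * qRe y - qI x * qI y - qJ x * qJ y - qK x * qK y)
  (qRe x * qI y + qI x * qRe y + qJ x * qK y - qK x * qJ y)
  (qRe x * qJ y - qI x * qK y + qJ x * qRe y + qK x * qI y)
  (qRe x * qK y + qI x * qJ y - qJ x * qI y + qK x * qRe y)"

definition "inverse x =
  (let n = (qRe x)\<^sup>2 + (qI x)\<^sup>2 + (qJ x)\<^sup>2 + (qK x)\<^sup>2
   in Quat (qRe x / n) (- qI x / n) (- qJ x / n) (- qK x / n))"

definition "x div (y::quat) = x * inverse y"

instance
proof
  fix x y z :: quat and r :: real
  show "x * y * z = x * (y * z)" "(x + y) * z = x * z + y * z" "x * (y + z) = x * y + x * z"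
    "1 * x = x" "x * 1 = x" "(0::quat) \<noteq> 1"
    "r *\<^sub>R x * y = r *\<^sub>R (x * y)" "x * r *\<^sub>R y = r *\<^sub>R (x * y)"
    by (simp_all add: times_quat_def one_quat_def quat_eq_iff algebra_simps)
  show "inverse (0::quat) = 0"
    by (simp add: inverse_quat_def zero_quat_def)
  show "x div y = x * inverse y"
    by (rule divide_quat_def)
  assume "x \<noteq> 0"
  then have "qRe x \<noteq> 0 \<or> qI x \<noteq> 0 \<or> qJ x \<noteq> 0 \<or> qK x \<noteq> 0"
    by (simp add: quat_eq_iff)
  then have "(qRe x)\<^sup>2 + (qI x)\<^sup>2 + (qJ x)\<^sup>2 + (qK x)\<^sup>2 > 0"
    using zero_le_power2[of "qRe x"] zero_le_power2[of "qI x"]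
      zero_le_power2[of "qJ x"] zero_le_power2[of "qK x"]
      zero_less_power2[of "qRe x"] zero_less_power2[of "qI x"]
      zero_less_power2[of "qJ x"] zero_less_power2[of "qK x"]
    by linarith
  then have n: "(qRe x)\<^sup>2 + (qI x)\<^sup>2 + (qJ x)\<^sup>2 + (qK x)\<^sup>2 \<noteq> 0" by simp
  define n where "n = (qRe x)\<^sup>2 + (qI x)\<^sup>2 + (qJ x)\<^sup>2 + (qK x)\<^sup>2"
  have n0: "n \<noteq> 0" using n by (simp add: n_def)
  have nn: "qRe x * qRe x + qI x * qI x + qJ x * qJ x + qK x * qK x = n"
    by (simp add: n_def power2_eq_square)
  have inv: "inverse x = (1 / n) *\<^sub>R Quat (qRe x) (- qI x) (- qJ x) (- qK x)"
    by (simp add: inverse_quat_def n_def Let_def scaleR_quat_def)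
  have "Quat (qRe x) (- qI x) (- qJ x) (- qK x) * x = n *\<^sub>R 1"
    "x * Quat (qRe x) (- qI x) (- qJ x) (- qK x) = n *\<^sub>R 1"
    by (simp_all add: times_quat_def one_quat_def quat_eq_iff nn[symmetric] algebra_simps)
  moreover have "r *\<^sub>R a * b = r *\<^sub>R (a * b)" "a * r *\<^sub>R b = r *\<^sub>R (a * b)"
    for a b :: quat and r
    by (simp_all add: times_quat_def quat_eq_iff algebra_simps)
  ultimately show "inverse x * x = 1" "x * inverse x = 1"
    using n0 by (simp_all add: inv)
qed

end

lemma quat_sel_one [simp]: "qRe 1 = 1" "qI 1 = 0" "qJ 1 = 0" "qK 1 = 0"
  by (simp_all add: one_quat_def)

lemma quat_sel_times [simp]:
  "qRe (x * y) = qRe x * qRe y - qI x * qI y - qJ x * qJ y - qK x * qK y"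
  "qI (x * y) = qRe x * qI y + qI x * qRe y + qJ x * qK y - qK x * qJ y"
  "qJ (x * y) = qRe x * qJ y - qI x * qK y + qJ x * qRe y + qK x * qI y"
  "qK (x * y) = qRe x * qK y + qI x * qJ y - qJ x * qI y + qK x * qRe y"
  by (simp_all add: times_quat_def)

lemma of_real_quat: "of_real r = Quat r 0 0 0"
  by (simp add: of_real_def quat_eq_iff)

instantiation quat :: real_inner
begin

definition "inner x y = qRe x * qRe y + qI x * qI y + qJ x * qJ y + qK x * qK y"
definition "norm x = sqrt ((qRe x)\<^sup>2 + (qI x)\<^sup>2 + (qJ x)\<^sup>2 + (qK x)\<^sup>2)"
definition "sgn x = x /\<^sub>R norm (x::quat)"
definition "dist x y = norm (x - y :: quat)"
definition "uniformity = (INF e\<in>{0<..}. principal {(x::quat, y). dist x y < e})"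
definition "open (U :: quat set) \<longleftrightarrow>
  (\<forall>x\<in>U. eventually (\<lambda>(x', y). x' = x \<longrightarrow> y \<in> U) uniformity)"

instance
proof
  fix x y z :: quat and r :: real and U :: "quat set"
  show "inner x y = inner y x"
    by (simp add: inner_quat_def mult.commute)
  show "inner (x + y) z = inner x z + inner y z"
    by (simp add: inner_quat_def distrib_right)
  show "inner (r *\<^sub>R x) y = r * inner x y"
    by (simp add: inner_quat_def distrib_left mult.assoc)
  show "0 \<le> inner x x"
    by (simp add: inner_quat_def)
  show "inner x x = 0 \<longleftrightarrow> x = 0"
    by (simp add: inner_quat_def quat_eq_iff add_nonneg_eq_0_iff)
  show "norm x = sqrt (inner x x)"
    by (simp add: inner_quat_def norm_quat_def power2_eq_square)
  show "sgn x = x /\<^sub>R norm x"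
    by (rule sgn_quat_def)
  show "dist x y = norm (x - y)"
    by (rule dist_quat_def)
  show "uniformity = (INF e\<in>{0<..}. principal {(x::quat, y). dist x y < e})"
    by (rule uniformity_quat_def)
  show "open U \<longleftrightarrow> (\<forall>x\<in>U. eventually (\<lambda>(x', y). x' = x \<longrightarrow> y \<in> U) uniformity)"
    by (rule open_quat_def)
qed

end

instance quat :: real_normed_div_algebra
proof
  fix x y :: quat
  show "norm (x * y) = norm x * norm y"
    unfolding norm_quat_def real_sqrt_mult [symmetric]
    by (rule arg_cong[where f = sqrt], simp only: quat_sel_times, algebra)
qed

instantiation quat :: euclidean_space
begin

definition "Basis = {Quat 1 0 0 0, Quat 0 1 0 0, Quat 0 0 1 0, Quat 0 0 0 1}"

instance
proof
  show "(Basis :: quat set) \<noteq> {}" "finite (Basis :: quat set)"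
    by (simp_all add: Basis_quat_def)
  fix x u v :: quat
  show "u \<in> Basis \<Longrightarrow> v \<in> Basis \<Longrightarrow> inner u v = (if u = v then 1 else 0)"
    unfolding Basis_quat_def by (elim insertE emptyE) (simp_all add: inner_quat_def)
  show "(\<forall>u\<in>Basis. inner x u = 0) \<longleftrightarrow> x = 0"
    by (simp add: Basis_quat_def inner_quat_def quat_eq_iff [of x])
qed

end

definition qcnj :: "quat \<Rightarrow> quat" where
  "qcnj q = Quat (qRe q) (- qI q) (- qJ q) (- qK q)"

text \<open>The norm of the instance above is the quaternionic modulus.\<close>

lemma quat_mult_qcnj: "q * qcnj q = of_real ((norm q)\<^sup>2)"
proof -
  have "0 \<le> (qRe q)\<^sup>2 + (qI q)\<^sup>2 + (qJ q)\<^sup>2 + (qK q)\<^sup>2" by simp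
  then show ?thesis
    by (simp add: qcnj_def of_real_quat norm_quat_def quat_eq_iff power2_eq_square)
qed

text \<open>For \<open>\<nu>\<^sup>2 = -1\<close>: the exponential of \<open>\<nu> \<theta>\<close> with real \<open>\<theta>\<close>.\<close>

definition qexp :: "quat \<Rightarrow> real \<Rightarrow> quat" where
  "qexp \<nu> \<theta> = of_real (cos \<theta>) + \<nu> * of_real (sin \<theta>)"

text \<open>
  The principal square root of a real number in the complex plane spanned by \<open>1\<close> and \<open>\<nu>\<close>.
  The parameters \<open>b\<close> and \<open>d\<close> of the transform may be negative. The choice of a root only
  changes the transform by a unit factor.
\<close>

definition qsqrt :: "quat \<Rightarrow> real \<Rightarrow> quat" where
  "qsqrt \<nu> r = (if 0 \<le> r then of_real (sqrt r) else \<nu> * of_real (sqrt (- r)))"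

text \<open>Norms take values in \<open>[0, \<infinity>]\<close>, so that finiteness is a meaningful assertion.\<close>

definition esqrt :: "ennreal \<Rightarrow> ennreal" where
  "esqrt x = (if x = top then top else ennreal (sqrt (enn2real x)))"

definition norm2Q :: "(real \<times> real \<Rightarrow> quat) \<Rightarrow> ennreal" where
  "norm2Q f = esqrt (\<integral>\<^sup>+ t. ennreal ((norm (f t))\<^sup>2) \<partial>lebesgue)"

definition L2Q :: "(real \<times> real \<Rightarrow> quat) set" where
  "L2Q = {f. f \<in> borel_measurable lebesgue \<and> norm2Q f < top}"

record olct_params =
  pa :: real
  pb :: real
  pc :: real
  pd :: real
  p\<tau> :: real
  p\<eta> :: real

text \<open>
  In \<open>olct_kernel\<close> the factor \<open>qexp \<nu> (- pi / 4)\<close> is \<open>1 / \<surd>\<nu>\<close>, so that the first two factors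
  stand for \<open>1 / \<surd>(\<nu> 2 \<pi> b)\<close>.
\<close>

definition olct_kernel :: "quat \<Rightarrow> olct_params \<Rightarrow> real \<Rightarrow> real \<Rightarrow> quat" where
  "olct_kernel \<nu> A x y =
     qexp \<nu> (- pi / 4) * inverse (qsqrt \<nu> (2 * pi * pb A)) *
     qexp \<nu> (1 / (2 * pb A) *
       (pa A * x\<^sup>2 - 2 * x * (y - p\<tau> A) - 2 * y * (pd A * p\<tau> A - pb A * p\<eta> A)
        + pd A * (y\<^sup>2 + (p\<tau> A)\<^sup>2)))"

definition olct_chirp :: "quat \<Rightarrow> olct_params \<Rightarrow> real \<Rightarrow> quat" where
  "olct_chirp \<nu> A y = qexp \<nu> (pc A * pd A / 2 * (y - p\<tau> A)\<^sup>2 + y * p\<tau> A)"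

text \<open>
  If exactly one of the parameters \<open>b\<close> vanishes, the remaining variable is integrated out. The
  transform is a Bochner integral, which is \<open>0\<close> where the integrand is not integrable.
\<close>

definition qolct ::
  "quat \<Rightarrow> quat \<Rightarrow> olct_params \<Rightarrow> olct_params \<Rightarrow> (real \<times> real \<Rightarrow> quat) \<Rightarrow> real \<times> real \<Rightarrow> quat"
where
  "qolct \<kappa> \<mu> A1 A2 h u =
    (if pb A1 \<noteq> 0 \<and> pb A2 \<noteq> 0 then
       (LINT s|lebesgue. olct_kernel \<kappa> A1 (fst s) (fst u) * h s * olct_kernel \<mu> A2 (snd s) (snd u))
     else if pb A1 = 0 \<and> pb A2 \<noteq> 0 then
       (LINT s2|lebesgue. qsqrt \<kappa> (pd A1) * olct_chirp \<kappa> A1 (fst u) *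
          h (pd A1 * (fst u - p\<tau> A1), s2) * olct_kernel \<mu> A2 s2 (snd u))
     else if pb A1 \<noteq> 0 \<and> pb A2 = 0 then
       (LINT s1|lebesgue. qsqrt \<mu> (pd A2) * olct_kernel \<kappa> A1 s1 (fst u) *
          h (s1, pd A2 * (snd u - p\<tau> A2)) * olct_chirp \<mu> A2 (snd u))
     else
       qsqrt \<kappa> (pd A1 * pd A2) * olct_chirp \<kappa> A1 (fst u) *
          h (pd A1 * (fst u - p\<tau> A1), pd A2 * (snd u - p\<tau> A2)) * olct_chirp \<mu> A2 (snd u))"

text \<open>
  The component-wise norm of the transform. It depends on \<open>h\<close> and not only on the value
  of the transform of \<open>h\<close> at \<open>u\<close>.
\<close>

definition qolct_norm ::
  "quat \<Rightarrow> quat \<Rightarrow> olct_params \<Rightarrow> olct_params \<Rightarrow> (real \<times> real \<Rightarrow> quat) \<Rightarrow> real \<times> real \<Rightarrow> real"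
where
  "qolct_norm \<kappa> \<mu> A1 A2 h u =
    sqrt (\<Sum>m\<leftarrow>[qRe, qI, qJ, qK]. (norm (qolct \<kappa> \<mu> A1 A2 (\<lambda>s. of_real (m (h s))) u))\<^sup>2)"

definition wvd_prod ::
  "(real \<times> real \<Rightarrow> quat) \<Rightarrow> (real \<times> real \<Rightarrow> quat) \<Rightarrow> real \<times> real \<Rightarrow> real \<times> real \<Rightarrow> quat"
where
  "wvd_prod f g t s = f (t + s /\<^sub>R 2) * qcnj (g (t - s /\<^sub>R 2))"

definition wvd ::
  "quat \<Rightarrow> quat \<Rightarrow> olct_params \<Rightarrow> olct_params \<Rightarrow>
   (real \<times> real \<Rightarrow> quat) \<Rightarrow> (real \<times> real \<Rightarrow> quat) \<Rightarrow> real \<times> real \<Rightarrow> real \<times> real \<Rightarrow> quat"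
where
  "wvd \<kappa> \<mu> A1 A2 f g t u = qolct \<kappa> \<mu> A1 A2 (wvd_prod f g t) u"

text \<open>The component-wise norm of \<open>wvd \<kappa> \<mu> A1 A2 f g t u\<close>.\<close>

definition wvd_norm ::
  "quat \<Rightarrow> quat \<Rightarrow> olct_params \<Rightarrow> olct_params \<Rightarrow>
   (real \<times> real \<Rightarrow> quat) \<Rightarrow> (real \<times> real \<Rightarrow> quat) \<Rightarrow> real \<times> real \<Rightarrow> real \<times> real \<Rightarrow> real"
where
  "wvd_norm \<kappa> \<mu> A1 A2 f g t u = qolct_norm \<kappa> \<mu> A1 A2 (wvd_prod f g t) u"

definition wvd_norm2Q ::
  "quat \<Rightarrow> quat \<Rightarrow> olct_params \<Rightarrow> olct_params \<Rightarrow>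
   (real \<times> real \<Rightarrow> quat) \<Rightarrow> (real \<times> real \<Rightarrow> quat) \<Rightarrow> ennreal"
where
  "wvd_norm2Q \<kappa> \<mu> A1 A2 f g =
    esqrt (\<integral>\<^sup>+ t. (\<integral>\<^sup>+ u. ennreal ((wvd_norm \<kappa> \<mu> A1 A2 f g t u)\<^sup>2) \<partial>lebesgue) \<partial>lebesgue)"

end

theory Submission
  imports Defs "HOL-Probability.Characteristic_Functions"
begin

text \<open>
  In one variable the kernel is, up to a factor of modulus \<open>1 / sqrt (2 * pi * \<bar>b\<bar>)\<close> and chirps in
  \<open>x\<close> and in \<open>y\<close>, the exponential \<open>qexp \<nu> (- x * y / b)\<close>. The transform is therefore an isometry by
  the Plancherel theorem, which is obtained by Gaussian regularization: the regularized energy of the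
  transform is a Gaussian mean of the autocorrelation \<open>z \<mapsto> \<integral> \<psi> (y + z) \<bullet> \<psi> y dy\<close>, and the
  autocorrelation is continuous at \<open>0\<close> because translations are continuous in \<open>L\<^sup>2\<close>.
  The two-sided transform is the composition of a transform in \<open>s\<^sub>1\<close> acting from the left and one in
  \<open>s\<^sub>2\<close> acting from the right, so Fubini's theorem makes it an isometry as well. For every \<open>t\<close> the
  function \<open>s \<mapsto> f (t + s / 2) * qcnj (g (t - s / 2))\<close> is integrable, and for almost every \<open>t\<close> it is
  square integrable. Integrating over \<open>t\<close> and substituting \<open>(t + s / 2, t - s / 2)\<close> factors the integral.
\<close>

section \<open>Continuity of translations and a Gaussian integral\<close>

text \<open>The left-hand norm is squared because the identity has to be homogeneous: scaling
  \<open>f\<close> by a real c must multiply both sides by c^2. Quaternions do not commute, so the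
  energy of a transform is expanded with the real inner product, for which left multiplication by an
  imaginary unit is orthogonal and skew. This treats every \<nu> alike, and conjugation carries the
  result over to multiplication from the right. The transform is a Bochner integral with default
  value 0, hence Plancherel is stated for functions in both L1 and L2: the first makes the integral
  meaningful, the second makes its energy finite. That the transform has finite energy is not known
  beforehand; the Gaussian weight makes the interchange of integrals absolutely convergent and is
  removed by monotone convergence. \<open>f\<close> and \<open>g\<close> are only Lebesgue
  measurable and are replaced by Borel representatives. The price is a proof that a change on a null
  set leaves the transform unchanged almost everywhere, even when a vanishing b restricts the
  function to lines or points.\<close>

lemma
  fixes f :: "'a::euclidean_space \<Rightarrow> 'b::{banach, second_countable_topology}"
  assumes "integrable lborel f"
  shows integrable_lborel_translate: "integrable lborel (\<lambda>x. f (x + h))"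
    and integral_lborel_translate: "(LINT x|lborel. f (x + h)) = (LINT x|lborel. f x)"
proof -
  have f: "f \<in> borel_measurable borel"
    using assms by auto
  have "integrable (distr lborel borel ((+) h)) f"
    using assms by (simp add: lborel_distr_plus)
  then show "integrable lborel (\<lambda>x. f (x + h))"
    using f by (subst (asm) integrable_distr_eq) (auto simp: add.commute)
  have "(LINT x|lborel. f x) = integral\<^sup>L (distr lborel borel ((+) h)) f"
    by (simp add: lborel_distr_plus)
  also have "\<dots> = (LINT x|lborel. f (x + h))"
    using f by (subst integral_distr) (auto simp: add.commute)
  finally show "(LINT x|lborel. f (x + h)) = (LINT x|lborel. f x)" by simp
qed

lemma nn_integral_lborel_translate:
  fixes f :: "'a::euclidean_space \<Rightarrow> ennreal"
  assumes "f \<in> borel_measurable borel"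
  shows "(\<integral>\<^sup>+x. f (x + h) \<partial>lborel) = (\<integral>\<^sup>+x. f x \<partial>lborel)"
proof -
  have "(\<integral>\<^sup>+x. f x \<partial>lborel) = integral\<^sup>N (distr lborel borel ((+) h)) f"
    by (simp add: lborel_distr_plus)
  also have "\<dots> = (\<integral>\<^sup>+x. f (x + h) \<partial>lborel)"
    using assms by (subst nn_integral_distr) (auto simp: add.commute)
  finally show ?thesis by simp
qed

text \<open>The two halves of the symmetric difference of \<open>A\<close> and its translate have
  equal measure, so one of them suffices. Enclose \<open>A\<close> in an open \<open>T\<close> with
  \<open>T - A\<close> small: a point of \<open>A\<close> stays in \<open>T\<close> under all small
  shifts, and the remaining error is at most the measure of \<open>T - A\<close>. The limit at 0 is
  taken along sequences to match dominated convergence.\<close>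

lemma L1_translation_tendsto_indicator:
  fixes A :: "'a::euclidean_space set"
  assumes A: "A \<in> sets borel" "emeasure lborel A < \<infinity>" and X: "X \<longlonglongrightarrow> 0"
  shows "(\<lambda>n. LINT x|lborel. \<bar>indicator A (x + X n) - indicator A x\<bar> :: real) \<longlonglongrightarrow> 0"
proof -
  note [measurable] = A(1)
  define R where "R n = (LINT x|lborel. indicator A x * (1 - indicator A (x + X n)) :: real)" for n
  have iA: "integrable lborel (indicator A :: 'a \<Rightarrow> real)"
    using A by (intro integrable_real_indicator) auto
  have iAt: "integrable lborel (\<lambda>x. indicator A (x + h) :: real)" for h
    by (rule integrable_lborel_translate[OF iA])
  have iR: "integrable lborel (\<lambda>x. indicator A x * (1 - indicator A (x + h)) :: real)" for h
    by (rule Bochner_Integration.integrable_bound[OF iA])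
       (auto simp: indicator_def)
  \<comment> \<open>For a, b in {0, 1} one has |a - b| = (a - b) + 2 b (1 - a), and a - b integrates
    to 0 by translation invariance.\<close>
  have eq: "(LINT x|lborel. \<bar>indicator A (x + X n) - indicator A x\<bar> :: real) = 2 * R n" for n
  proof -
    have "(LINT x|lborel. \<bar>indicator A (x + X n) - indicator A x\<bar> :: real)
      = (LINT x|lborel. (indicator A (x + X n) - indicator A x)
          + 2 * (indicator A x * (1 - indicator A (x + X n))))"
      by (intro Bochner_Integration.integral_cong) (auto simp: indicator_def)
    also have "\<dots> = 2 * R n"
      using iAt[of "X n"] iA iR[of "X n"] integral_lborel_translate[OF iA, of "X n"]
      by (simp add: R_def Bochner_Integration.integral_diff)
    finally show ?thesis .
  qed
  have "R \<longlonglongrightarrow> 0"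
  proof (rule LIMSEQ_I)
    fix r :: real assume r: "0 < r"
    have "A \<in> sets lebesgue" using A by simp
    then obtain T where T: "open T" "A \<subseteq> T" "T - A \<in> lmeasurable"
      "emeasure lebesgue (T - A) < ennreal (r/2)"
      using sets_lebesgue_outer_open[of A "r/2"] r by auto
    have [measurable]: "T \<in> sets borel" using T(1) by simp
    have em: "emeasure lborel (T - A) < ennreal (r/2)"
      using T(4) by simp
    have iTA: "integrable lborel (indicator (T - A) :: 'a \<Rightarrow> real)"
      using em by (intro integrable_real_indicator) (auto simp: less_top[symmetric])
    have mTA: "(LINT x|lborel. indicator (T - A) (x + h) :: real) < r/2" for h
    proof -
      have "ennreal (measure lborel (T - A)) < ennreal (r/2)"
        using em by (subst emeasure_eq_ennreal_measure[symmetric]) (auto simp: less_top[symmetric])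
      then show ?thesis
        using r by (subst integral_lborel_translate[OF iTA]) (simp add: ennreal_less_iff)
    qed
    have iT: "integrable lborel (\<lambda>x. indicator A x * (1 - indicator T (x + h)) :: real)" for h
      by (rule Bochner_Integration.integrable_bound[OF iA]) (auto simp: indicator_def)
    have "(\<lambda>n. LINT x|lborel. indicator A x * (1 - indicator T (x + X n)) :: real)
      \<longlonglongrightarrow> (LINT x::'a|lborel. 0)"
    proof (rule integral_dominated_convergence[where w="indicator A"])
      show "AE x in lborel. (\<lambda>n. indicator A x * (1 - indicator T (x + X n)) :: real) \<longlonglongrightarrow> 0"
      proof (rule AE_I2, rule tendsto_eventually)
        fix x
        show "\<forall>\<^sub>F n in sequentially. indicator A x * (1 - indicator T (x + X n)) = (0::real)"
        proof (cases "x \<in> A")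
          case True
          have "(\<lambda>n. x + X n) \<longlonglongrightarrow> x + 0" by (intro tendsto_intros X)
          then have "\<forall>\<^sub>F n in sequentially. x + X n \<in> T"
            using T True topological_tendstoD by fastforce
          then show ?thesis by eventually_elim simp
        qed simp
      qed
    qed (use iA in \<open>auto simp: indicator_def\<close>)
    then have "(\<lambda>n. LINT x|lborel. indicator A x * (1 - indicator T (x + X n)) :: real) \<longlonglongrightarrow> 0"
      by simp
    then have "\<forall>\<^sub>F n in sequentially.
        (LINT x|lborel. indicator A x * (1 - indicator T (x + X n)) :: real) < r/2"
      by (rule order_tendstoD(2)) (use r in simp)
    then have "\<forall>\<^sub>F n in sequentially. norm (R n - 0) < r"
    proof eventually_elim
      case (elim n)
      \<comment> \<open>A point of \<open>A\<close> whose translate leaves \<open>A\<close> either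
        leaves \<open>T\<close> or lands in \<open>T - A\<close>.\<close>
      have "R n \<le> (LINT x|lborel. indicator A x * (1 - indicator T (x + X n))
          + indicator (T - A) (x + X n) :: real)"
        unfolding R_def
        by (intro integral_mono iR Bochner_Integration.integrable_add iT integrable_lborel_translate iTA)
           (auto simp: indicator_def)
      also have "\<dots> = (LINT x|lborel. indicator A x * (1 - indicator T (x + X n)) :: real)
          + (LINT x|lborel. indicator (T - A) (x + X n))"
        by (intro Bochner_Integration.integral_add iT integrable_lborel_translate iTA)
      also have "\<dots> < r" using elim mTA[of "X n"] by simp
      finally have "R n < r" .
      moreover have "0 \<le> R n"
        unfolding R_def by (intro integral_nonneg_AE) (auto simp: indicator_def)
      ultimately show ?case by simp
    qed
    then show "\<exists>no. \<forall>n\<ge>no. norm (R n - 0) < r"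
      by (simp add: eventually_sequentially)
  qed
  then show ?thesis
    unfolding eq by (auto intro: tendsto_mult_right_zero)
qed

text \<open>The property passes from indicators to sums by the triangle inequality, and to dominated
  limits by an estimate with three errors, two of which agree by translation invariance.\<close>

lemma L1_translation_tendsto:
  fixes f :: "'a::euclidean_space \<Rightarrow> 'b::{banach, second_countable_topology}"
  assumes "integrable lborel f" and X: "X \<longlonglongrightarrow> 0"
  shows "(\<lambda>n. LINT x|lborel. norm (f (x + X n) - f x)) \<longlonglongrightarrow> 0"
  using assms(1)
proof (induction rule: integrable_induct)
  case (base A c)
  have eq: "norm (indicator A (x + h) *\<^sub>R c - indicator A x *\<^sub>R c)
      = \<bar>indicator A (x + h) - indicator A x\<bar> * norm c" for x h
    by (simp add: scaleR_diff_left[symmetric])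
  show ?case
    unfolding eq
    using tendsto_mult_left_zero[OF L1_translation_tendsto_indicator[of A X], of "norm c"] base X
    by simp
next
  case (add f g)
  note tr = integrable_lborel_translate
  show ?case
  proof (rule tendsto_sandwich[OF _ _ tendsto_const])
    show "(\<lambda>n. (LINT x|lborel. norm (f (x + X n) - f x)) + (LINT x|lborel. norm (g (x + X n) - g x)))
        \<longlonglongrightarrow> 0"
      using tendsto_add[OF add.IH] by simp
    show "\<forall>\<^sub>F n in sequentially. (LINT x|lborel. norm (f (x + X n) + g (x + X n) - (f x + g x)))
      \<le> (LINT x|lborel. norm (f (x + X n) - f x)) + (LINT x|lborel. norm (g (x + X n) - g x))"
    proof (rule always_eventually, rule allI)
      fix n
      have "(LINT x|lborel. norm (f (x + X n) + g (x + X n) - (f x + g x)))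
        \<le> (LINT x|lborel. norm (f (x + X n) - f x) + norm (g (x + X n) - g x))"
        using add.hyps
        by (intro integral_mono Bochner_Integration.integrable_add Bochner_Integration.integrable_diff
              integrable_norm tr)
           (auto simp: add_diff_add norm_triangle_ineq)
      also have "\<dots> = (LINT x|lborel. norm (f (x + X n) - f x)) + (LINT x|lborel. norm (g (x + X n) - g x))"
        using add.hyps
        by (intro Bochner_Integration.integral_add Bochner_Integration.integrable_diff integrable_norm tr)
      finally show "(LINT x|lborel. norm (f (x + X n) + g (x + X n) - (f x + g x)))
        \<le> (LINT x|lborel. norm (f (x + X n) - f x)) + (LINT x|lborel. norm (g (x + X n) - g x))" .
    qed
  qed simp
next
  case (lim f s)
  note tr = integrable_lborel_translate
  have pw: "(\<lambda>i. s i x) \<longlonglongrightarrow> f x" for x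
    by (rule lim.hyps) simp
  have bd: "norm (s i x) \<le> 2 * norm (f x)" for i x
    by (rule lim.hyps) simp
  have i: "integrable lborel (\<lambda>x. norm (f x - s i x))" for i
    using lim.hyps(1,4) by (intro integrable_norm Bochner_Integration.integrable_diff)
  \<comment> \<open>The induction rule bounds \<open>s i\<close> by 2 |f|, whence the dominating
    function 3 |f| for the differences.\<close>
  have "(\<lambda>i. LINT x|lborel. norm (f x - s i x)) \<longlonglongrightarrow> (LINT x::'a|lborel. 0)"
  proof (rule integral_dominated_convergence[where w="\<lambda>x. 3 * norm (f x)"])
    show "AE x in lborel. (\<lambda>i. norm (f x - s i x)) \<longlonglongrightarrow> 0"
    proof (rule AE_I2)
      fix x
      have "(\<lambda>i. norm (f x - s i x)) \<longlonglongrightarrow> norm (f x - f x)"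
        by (rule tendsto_norm[OF tendsto_diff[OF tendsto_const pw]])
      then show "(\<lambda>i. norm (f x - s i x)) \<longlonglongrightarrow> 0" by simp
    qed
    show "AE x in lborel. norm (norm (f x - s i x)) \<le> 3 * norm (f x)" for i
    proof (rule AE_I2)
      fix x
      show "norm (norm (f x - s i x)) \<le> 3 * norm (f x)"
        using norm_triangle_ineq4[of "f x" "s i x"] bd[of i x] by simp
    qed
  qed (use lim.hyps(4) i in \<open>auto simp: borel_measurable_integrable\<close>)
  then have apx: "(\<lambda>i. LINT x|lborel. norm (f x - s i x)) \<longlonglongrightarrow> 0" by simp
  show ?case
  proof (rule LIMSEQ_I)
    fix r :: real assume "0 < r"
    then have "\<forall>\<^sub>F i in sequentially. (LINT x|lborel. norm (f x - s i x)) < r/3"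
      by (intro order_tendstoD(2)[OF apx]) simp
    \<comment> \<open>The approximant is fixed before \<open>n\<close>; its single error bound then
      serves both at x and at x + X n.\<close>
    then obtain i where i3: "(LINT x|lborel. norm (f x - s i x)) < r/3"
      using eventually_happens'[OF sequentially_bot] by blast
    have "\<forall>\<^sub>F n in sequentially. (LINT x|lborel. norm (s i (x + X n) - s i x)) < r/3"
      by (rule order_tendstoD(2)[OF lim.IH[of i]]) (use \<open>0 < r\<close> in simp)
    then have "\<forall>\<^sub>F n in sequentially. norm ((LINT x|lborel. norm (f (x + X n) - f x)) - 0) < r"
    proof eventually_elim
      case (elim n)
      have isx: "integrable lborel (\<lambda>x. norm (s i (x + X n) - s i x))"
        using lim.hyps(1,4) by (intro integrable_norm Bochner_Integration.integrable_diff tr)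
      have "(LINT x|lborel. norm (f (x + X n) - f x)) \<le>
         (LINT x|lborel. norm (f (x + X n) - s i (x + X n)) + norm (f x - s i x)
            + norm (s i (x + X n) - s i x))"
      proof (rule integral_mono)
        show "integrable lborel (\<lambda>x. norm (f (x + X n) - f x))"
          using lim.hyps(1,4) by (intro integrable_norm Bochner_Integration.integrable_diff tr)
        show "integrable lborel (\<lambda>x. norm (f (x + X n) - s i (x + X n)) + norm (f x - s i x)
            + norm (s i (x + X n) - s i x))"
          by (intro Bochner_Integration.integrable_add tr[OF i] i isx)
        fix x
        have "norm (f (x + X n) - f x) = norm ((f (x + X n) - s i (x + X n)) - (f x - s i x)
            + (s i (x + X n) - s i x))" by simp
        also have "\<dots> \<le> norm (f (x + X n) - s i (x + X n)) + norm (f x - s i x)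
            + norm (s i (x + X n) - s i x)"
          by (rule order_trans[OF norm_triangle_ineq add_right_mono[OF norm_triangle_ineq4]])
        finally show "norm (f (x + X n) - f x) \<le> norm (f (x + X n) - s i (x + X n)) + norm (f x - s i x)
            + norm (s i (x + X n) - s i x)" .
      qed
      also have "\<dots> = (LINT x|lborel. norm (f x - s i x)) + (LINT x|lborel. norm (f x - s i x))
          + (LINT x|lborel. norm (s i (x + X n) - s i x))"
        by (simp only: Bochner_Integration.integral_add Bochner_Integration.integrable_add tr[OF i] i isx
              integral_lborel_translate[OF i])
      also have "\<dots> < r" using i3 elim by simp
      finally show ?case
        by (simp add: integral_nonneg_AE)
    qed
    then show "\<exists>no. \<forall>n\<ge>no. norm ((LINT x|lborel. norm (f (x + X n) - f x)) - 0) < r"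
      by (simp add: eventually_sequentially)
  qed
qed

text \<open>The map a -> |a| a turns square integrable functions into integrable ones, and this
  inequality carries continuity of translations back from L1 to L2. With D = |a| a - |b| b, twice
  the inner product of D and a - b is (|a| + |b|) (|a - b|^2 + (|a| - |b|)^2): drop the last square,
  then use Cauchy-Schwarz and |a - b| \<le> |a| + |b|. The constant 2 is attained at b = -
  a.\<close>

lemma power2_norm_diff_le:
  fixes a b :: "'a::real_inner"
  shows "(norm (a - b))\<^sup>2 \<le> 2 * norm (norm a *\<^sub>R a - norm b *\<^sub>R b)"
proof -
  let ?A = "norm a" and ?B = "norm b"
  define D where "D = norm a *\<^sub>R a - norm b *\<^sub>R b"
  have n2: "(norm (a - b))\<^sup>2 = ?A\<^sup>2 + ?B\<^sup>2 - 2 * inner a b"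
    by (simp add: power2_norm_eq_inner inner_diff_left inner_diff_right inner_commute)
  have aa: "inner a a = ?A\<^sup>2" "inner b b = ?B\<^sup>2" by (simp_all add: power2_norm_eq_inner)
  have "2 * inner D (a - b) = 2 * ?A^3 + 2 * ?B^3 - 2 * (?A + ?B) * inner a b"
    by (simp add: D_def inner_diff_left inner_diff_right aa inner_commute[of b a]
        power2_eq_square power3_eq_cube algebra_simps)
  also have "\<dots> = (?A + ?B) * (norm (a - b))\<^sup>2 + (?A + ?B) * (?A - ?B)\<^sup>2"
    unfolding n2 by (simp add: power2_eq_square power3_eq_cube algebra_simps)
  finally have "(?A + ?B) * (norm (a - b))\<^sup>2 \<le> 2 * inner D (a - b)" by simp
  also have "\<dots> \<le> 2 * (norm D * norm (a - b))"
    using norm_cauchy_schwarz[of D "a - b"] by simp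
  finally have 1: "(?A + ?B) * (norm (a - b))\<^sup>2 \<le> 2 * (norm D * norm (a - b))" .
  have "norm (a - b) * (norm (a - b))\<^sup>2 \<le> (?A + ?B) * (norm (a - b))\<^sup>2"
    by (intro mult_right_mono norm_triangle_ineq4) simp
  then have "norm (a - b) * (norm (a - b))\<^sup>2 \<le> 2 * (norm D * norm (a - b))"
    using 1 by (rule order_trans)
  also have "\<dots> = norm (a - b) * (2 * norm D)" by algebra
  finally have "norm (a - b) * (norm (a - b))\<^sup>2 \<le> norm (a - b) * (2 * norm D)" .
  then show ?thesis
    by (cases "a = b") (auto simp: D_def)
qed

lemma L2_translation_tendsto:
  fixes f :: "'a::euclidean_space \<Rightarrow> 'b::euclidean_space"
  assumes [measurable]: "f \<in> borel_measurable borel"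
    and f2: "integrable lborel (\<lambda>x. (norm (f x))\<^sup>2)" and X: "X \<longlonglongrightarrow> 0"
  shows "(\<lambda>n. LINT x|lborel. (norm (f (x + X n) - f x))\<^sup>2) \<longlonglongrightarrow> 0"
proof -
  define F where "F x = norm (f x) *\<^sub>R f x" for x
  have [measurable]: "F \<in> borel_measurable borel"
    unfolding F_def by measurable
  have F: "integrable lborel F"
    by (rule Bochner_Integration.integrable_bound[OF f2])
       (auto simp: F_def power2_eq_square)
  have iF: "integrable lborel (\<lambda>x. 2 * norm (F (x + h) - F x))" for h
    using F by (intro integrable_mult_right integrable_norm Bochner_Integration.integrable_diff
        integrable_lborel_translate)
  have le: "(norm (f (x + h) - f x))\<^sup>2 \<le> 2 * norm (F (x + h) - F x)" for x h
    unfolding F_def by (rule power2_norm_diff_le)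
  show ?thesis
  proof (rule tendsto_sandwich[OF _ _ tendsto_const])
    show "(\<lambda>n. LINT x|lborel. 2 * norm (F (x + X n) - F x)) \<longlonglongrightarrow> 0"
      using tendsto_mult_right_zero[OF L1_translation_tendsto[OF F X], of 2] by simp
    show "\<forall>\<^sub>F n in sequentially. (LINT x|lborel. (norm (f (x + X n) - f x))\<^sup>2)
        \<le> (LINT x|lborel. 2 * norm (F (x + X n) - F x))"
      by (intro always_eventually allI integral_mono iF le
           Bochner_Integration.integrable_bound[OF iF[of "X _"]])
         (auto intro!: AE_I2 order_trans[OF le])
  qed simp
qed

text \<open>The integrals are the real and imaginary parts of the characteristic function of the
  standard normal distribution at a / \<delta>, after rescaling the variable by \<delta>.\<close>

lemma
  fixes a \<delta> :: real
  assumes "0 < \<delta>"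
  shows integral_gauss_cos:
      "(LINT \<xi>|lborel. exp (- (\<delta> * \<xi>)\<^sup>2 / 2) * cos (a * \<xi>)) = sqrt (2 * pi) / \<delta> * exp (- (a / \<delta>)\<^sup>2 / 2)"
    and integral_gauss_sin: "(LINT \<xi>|lborel. exp (- (\<delta> * \<xi>)\<^sup>2 / 2) * sin (a * \<xi>)) = 0"
    and integrable_gauss: "integrable lborel (\<lambda>\<xi>. exp (- (\<delta> * \<xi>)\<^sup>2 / 2))"
proof -
  let ?t = "a / \<delta>"
  have std: "integrable lborel std_normal_density"
    using integrable_normal_density[of 1 0] by simp
  have g0: "integrable lborel (\<lambda>x. exp (- x\<^sup>2 / 2) :: real)"
    using integrable_mult_right[OF std, of "sqrt (2 * pi)"]
    by (simp add: std_normal_density_def)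
  have g: "integrable lborel (\<lambda>x. std_normal_density x *\<^sub>R iexp (?t * x))"
    by (rule Bochner_Integration.integrable_bound[OF std])
       (auto simp: norm_mult)
  have "(LINT x|lborel. std_normal_density x *\<^sub>R iexp (?t * x)) = complex_of_real (exp (- ?t\<^sup>2 / 2))"
    using fun_cong[OF char_std_normal_distribution, of ?t]
    unfolding char_def by (subst (asm) integral_density) auto
  then have eq: "Re (LINT x|lborel. std_normal_density x *\<^sub>R iexp (?t * x)) = exp (- ?t\<^sup>2 / 2)"
     "Im (LINT x|lborel. std_normal_density x *\<^sub>R iexp (?t * x)) = 0"
    by (simp_all only: Re_complex_of_real Im_complex_of_real)
  have eq': "(LINT x|lborel. std_normal_density x * cos (?t * x)) = exp (- ?t\<^sup>2 / 2)"
      "(LINT x|lborel. std_normal_density x * sin (?t * x)) = 0"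
    using eq unfolding integral_Re[OF g, symmetric] integral_Im[OF g, symmetric]
    by (simp_all add: Re_exp Im_exp)
  have sc: "(LINT x|lborel. exp (- (\<delta> * x)\<^sup>2 / 2) * F (a * x))
       = sqrt (2 * pi) / \<delta> * (LINT x|lborel. std_normal_density x * F (?t * x))" for F :: "real \<Rightarrow> real"
  proof -
    have "(LINT x|lborel. exp (- (\<delta> * x)\<^sup>2 / 2) * F (a * x))
      = (1 / \<delta>) * (LINT x|lborel. exp (- x\<^sup>2 / 2) * F (?t * x))"
      using assms by (subst lborel_integral_real_affine[where c="1/\<delta>" and t=0]) auto
    also have "(LINT x|lborel. exp (- x\<^sup>2 / 2) * F (?t * x))
      = (LINT x|lborel. sqrt (2 * pi) * (std_normal_density x * F (?t * x)))"
      by (simp add: std_normal_density_def)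
    finally show ?thesis by simp
  qed
  show "(LINT \<xi>|lborel. exp (- (\<delta> * \<xi>)\<^sup>2 / 2) * cos (a * \<xi>)) = sqrt (2 * pi) / \<delta> * exp (- (a / \<delta>)\<^sup>2 / 2)"
    "(LINT \<xi>|lborel. exp (- (\<delta> * \<xi>)\<^sup>2 / 2) * sin (a * \<xi>)) = 0"
    by (simp_all only: sc[of cos] sc[of sin] eq' mult_zero_right)
  show "integrable lborel (\<lambda>\<xi>. exp (- (\<delta> * \<xi>)\<^sup>2 / 2))"
    using lborel_integrable_real_affine[OF g0, of \<delta> 0] assms by simp
qed

section \<open>Plancherel theorem for the quaternionic Fourier transform\<close>

lemma quat_imaginary_unit:
  fixes \<nu> :: quat
  assumes "\<nu>\<^sup>2 = -1"
  shows "qRe \<nu> = 0" "(qI \<nu>)\<^sup>2 + (qJ \<nu>)\<^sup>2 + (qK \<nu>)\<^sup>2 = 1"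
proof -
  \<comment> \<open>The imaginary part of \<open>\<nu>\<^sup>2\<close> is 2 Re(\<nu>) Im(\<nu>). If
    Re(\<nu>) were nonzero, \<nu> would be real with square -1.\<close>
  have re: "(qRe \<nu>)\<^sup>2 - ((qI \<nu>)\<^sup>2 + (qJ \<nu>)\<^sup>2 + (qK \<nu>)\<^sup>2) = -1"
    and im: "qRe \<nu> * qI \<nu> = 0" "qRe \<nu> * qJ \<nu> = 0" "qRe \<nu> * qK \<nu> = 0"
    using assms by (simp_all add: quat_eq_iff power2_eq_square algebra_simps)
  show "qRe \<nu> = 0"
  proof (rule ccontr)
    assume "qRe \<nu> \<noteq> 0"
    then have "(qRe \<nu>)\<^sup>2 = -1" using re im by simp
    then show False using zero_le_power2[of "qRe \<nu>"] by linarith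
  qed
  then show "(qI \<nu>)\<^sup>2 + (qJ \<nu>)\<^sup>2 + (qK \<nu>)\<^sup>2 = 1" using re by simp
qed

lemma norm_quat_imaginary_unit:
  fixes \<nu> :: quat
  assumes "\<nu>\<^sup>2 = -1"
  shows "norm \<nu> = 1"
  using quat_imaginary_unit[OF assms] by (simp add: norm_quat_def)

lemma qexp_add:
  assumes "\<nu>\<^sup>2 = -1"
  shows "qexp \<nu> (a + b) = qexp \<nu> a * qexp \<nu> b"
proof -
  have "qexp \<nu> a * qexp \<nu> b = of_real (cos a * cos b) + (\<nu> * \<nu>) * of_real (sin a * sin b)
      + \<nu> * of_real (sin a * cos b + cos a * sin b)"
    by (simp add: qexp_def of_real_quat quat_eq_iff algebra_simps)
  also have "\<nu> * \<nu> = -1" using assms by (simp add: power2_eq_square)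
  finally show ?thesis
    by (simp add: qexp_def cos_add sin_add of_real_quat quat_eq_iff algebra_simps)
qed

lemma qexp_inner:
  assumes "\<nu>\<^sup>2 = -1"
  shows "inner (qexp \<nu> a * p) (qexp \<nu> b * q) = cos (a - b) * inner p q + sin (a - b) * inner (\<nu> * p) q"
proof -
  note u = quat_imaginary_unit[OF assms]
  have "inner (qexp \<nu> a * p) (qexp \<nu> b * q) =
     (cos a * cos b + ((qI \<nu>)\<^sup>2 + (qJ \<nu>)\<^sup>2 + (qK \<nu>)\<^sup>2) * (sin a * sin b)) * inner p q
     + (sin a * cos b - cos a * sin b) * inner (\<nu> * p) q"
    by (simp add: inner_quat_def qexp_def of_real_quat u(1) algebra_simps power2_eq_square)
  then show ?thesis
    by (simp add: u(2) cos_diff sin_diff)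
qed

lemma norm_qexp:
  assumes "\<nu>\<^sup>2 = -1"
  shows "norm (qexp \<nu> a) = 1"
  using qexp_inner[OF assms, of a 1 a 1] by (simp add: norm_eq_sqrt_inner[of "qexp \<nu> a"])
    (simp add: inner_quat_def)

lemma borel_measurable_qexp [measurable (raw)]:
  assumes "h \<in> borel_measurable M"
  shows "(\<lambda>x. qexp \<nu> (h x)) \<in> borel_measurable M"
  using assms unfolding qexp_def by measurable

text \<open>By Tonelli and translation invariance the double integral is the product of the two L1
  norms. It is the common dominating function for the double integrals of the autocorrelation
  argument.\<close>

lemma integrable_product_norm_mult_translate:
  fixes f g :: "real \<Rightarrow> 'b::euclidean_space"
  assumes f: "integrable lborel f" and g: "integrable lborel g"
  shows "integrable (lborel \<Otimes>\<^sub>M lborel) (\<lambda>(y, z). norm (f (y + z)) * norm (g y))"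
proof (rule integrableI_bounded)
  have [measurable]: "f \<in> borel_measurable borel" "g \<in> borel_measurable borel"
    using f g by auto
  show "(\<lambda>(y, z). norm (f (y + z)) * norm (g y)) \<in> borel_measurable (lborel \<Otimes>\<^sub>M lborel)"
    by measurable
  have "(\<integral>\<^sup>+ p. ennreal (norm (case p of (y, z) \<Rightarrow> norm (f (y + z)) * norm (g y))) \<partial>(lborel \<Otimes>\<^sub>M lborel))
     = (\<integral>\<^sup>+ y. \<integral>\<^sup>+ z. ennreal (norm (g y)) * ennreal (norm (f (z + y))) \<partial>lborel \<partial>lborel)"
    by (subst lborel.nn_integral_fst[symmetric]) (simp_all add: ennreal_mult' ac_simps abs_mult)
  also have "\<dots> = (\<integral>\<^sup>+ y. ennreal (norm (g y)) * (\<integral>\<^sup>+ z. ennreal (norm (f z)) \<partial>lborel) \<partial>lborel)"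
    by (subst nn_integral_cmult, simp, subst nn_integral_lborel_translate) auto
  also have "\<dots> = (\<integral>\<^sup>+ y. ennreal (norm (g y)) \<partial>lborel) * (\<integral>\<^sup>+ z. ennreal (norm (f z)) \<partial>lborel)"
    by (subst nn_integral_multc) auto
  also have "\<dots> < \<infinity>"
    using f g by (auto simp: integrable_iff_bounded ennreal_mult_less_top)
  finally show "(\<integral>\<^sup>+ p. ennreal (norm (case p of (y, z) \<Rightarrow> norm (f (y + z)) * norm (g y))) \<partial>(lborel \<Otimes>\<^sub>M lborel)) < \<infinity>" .
qed

text \<open>
  The sine part of the squared transform is odd in \<open>\<xi>\<close> and disappears after integration
  against the Gaussian; only the autocorrelation \<open>A\<close> survives.
\<close>

lemma gauss_regularized_plancherel:
  fixes \<psi> :: "real \<Rightarrow> quat"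
  assumes \<nu>: "\<nu>\<^sup>2 = -1" and \<psi>: "integrable lborel \<psi>" and \<delta>: "0 < \<delta>"
  defines "F \<equiv> \<lambda>\<xi>. LINT x|lborel. qexp \<nu> (- (x * \<xi>)) * \<psi> x"
    and "A \<equiv> \<lambda>z. LINT y|lborel. inner (\<psi> (y + z)) (\<psi> y)"
  shows "integrable lborel (\<lambda>\<xi>. exp (- (\<delta> * \<xi>)\<^sup>2 / 2) * (norm (F \<xi>))\<^sup>2)"
    and "(LINT \<xi>|lborel. exp (- (\<delta> * \<xi>)\<^sup>2 / 2) * (norm (F \<xi>))\<^sup>2)
      = sqrt (2 * pi) * (LINT w|lborel. exp (- w\<^sup>2 / 2) * A (\<delta> * w))"
proof -
  have m\<psi>[measurable]: "\<psi> \<in> borel_measurable borel"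
    using \<psi> by auto
  have n\<nu>: "norm \<nu> = 1" by (rule norm_quat_imaginary_unit[OF \<nu>])
  \<comment> \<open>The correlation twisted by \<nu>: it is the coefficient of the sine in
    \<open>qexp_inner\<close>, and the same domination applies to it as to \<open>A\<close>.\<close>
  define B where "B z = (LINT y|lborel. inner (\<nu> * \<psi> (y + z)) (\<psi> y))" for z
  note dom = integrable_product_norm_mult_translate[OF \<psi> \<psi>]
  have iA2: "integrable (lborel \<Otimes>\<^sub>M lborel) (\<lambda>(y, z). inner (\<psi> (y + z)) (\<psi> y))"
    by (rule Bochner_Integration.integrable_bound[OF dom]) (auto simp: Cauchy_Schwarz_ineq2)
  have iB2: "integrable (lborel \<Otimes>\<^sub>M lborel) (\<lambda>(y, z). inner (\<nu> * \<psi> (y + z)) (\<psi> y))"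
    by (rule Bochner_Integration.integrable_bound[OF dom])
       (auto intro!: order_trans[OF Cauchy_Schwarz_ineq2] simp: norm_mult n\<nu>)
  have iA: "integrable lborel A" and iB: "integrable lborel B"
    using lborel_pair.integrable_snd[of "\<lambda>y z. inner (\<psi> (y + z)) (\<psi> y)"] iA2
      lborel_pair.integrable_snd[of "\<lambda>y z. inner (\<nu> * \<psi> (y + z)) (\<psi> y)"] iB2
    by (simp_all add: A_def B_def[abs_def])
  have [measurable]: "A \<in> borel_measurable borel" "B \<in> borel_measurable borel"
    using iA iB by auto
  have i\<psi>: "integrable lborel (\<lambda>x. qexp \<nu> (- (x * \<xi>)) * \<psi> x)" for \<xi>
    by (rule Bochner_Integration.integrable_bound[OF \<psi>]) (auto simp: norm_mult norm_qexp[OF \<nu>])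
  have mF[measurable]: "F \<in> borel_measurable borel"
    unfolding F_def by measurable
  have F2: "(norm (F \<xi>))\<^sup>2 = (LINT z|lborel. cos (z * \<xi>) * A z - sin (z * \<xi>) * B z)" for \<xi>
  proof -
    let ?G = "\<lambda>y z. inner (qexp \<nu> (- ((y + z) * \<xi>)) * \<psi> (y + z)) (qexp \<nu> (- (y * \<xi>)) * \<psi> y)"
    have G: "?G y z = cos (z * \<xi>) * inner (\<psi> (y + z)) (\<psi> y) - sin (z * \<xi>) * inner (\<nu> * \<psi> (y + z)) (\<psi> y)"
      for y z
    proof -
      have "- ((y + z) * \<xi>) - - (y * \<xi>) = - (z * \<xi>)" by (simp add: algebra_simps)
      then show ?thesis by (simp only: qexp_inner[OF \<nu>] cos_minus sin_minus mult_minus_left add_uminus_conv_diff)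
    qed
    have iG: "integrable (lborel \<Otimes>\<^sub>M lborel) (\<lambda>(y, z). ?G y z)"
      by (rule Bochner_Integration.integrable_bound[OF dom])
         (auto intro!: order_trans[OF Cauchy_Schwarz_ineq2] simp: norm_mult norm_qexp[OF \<nu>])
    have "(norm (F \<xi>))\<^sup>2 = inner (F \<xi>) (F \<xi>)" by (simp add: power2_norm_eq_inner)
    also have "\<dots> = (LINT y|lborel. inner (F \<xi>) (qexp \<nu> (- (y * \<xi>)) * \<psi> y))"
      unfolding F_def by (simp only: integral_inner_right i\<psi>)
    also have "\<dots> = (LINT y|lborel. LINT z|lborel. ?G y z)"
    proof (rule Bochner_Integration.integral_cong)
      fix y
      \<comment> \<open>Translating the inner variable by \<open>y\<close> makes the phase
        difference \<open>- (z * \<xi>)\<close>, which is free of \<open>y\<close>, so the integral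
        over \<open>y\<close> can be done first.\<close>
      have "F \<xi> = (LINT z|lborel. qexp \<nu> (- ((z + y) * \<xi>)) * \<psi> (z + y))"
        unfolding F_def by (rule integral_lborel_translate[OF i\<psi>, symmetric])
      then show "inner (F \<xi>) (qexp \<nu> (- (y * \<xi>)) * \<psi> y) = (LINT z|lborel. ?G y z)"
        using integral_inner_left[OF integrable_lborel_translate[OF i\<psi>[of \<xi>], of y]]
        by (simp add: add.commute)
    qed simp
    also have "\<dots> = (LINT z|lborel. LINT y|lborel. ?G y z)"
      using lborel_pair.Fubini_integral[OF iG] by simp
    also have "\<dots> = (LINT z|lborel. cos (z * \<xi>) * A z - sin (z * \<xi>) * B z)"
    proof (rule integral_cong_AE)
      \<comment> \<open>Here \<psi> is only known to be integrable, so the correlation integrals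
        converge for almost every \<open>z\<close> and the splitting into \<open>A\<close> and
        \<open>B\<close> is made there.\<close>
      have "AE z in lborel. integrable lborel (\<lambda>y. inner (\<psi> (y + z)) (\<psi> y))"
        "AE z in lborel. integrable lborel (\<lambda>y. inner (\<nu> * \<psi> (y + z)) (\<psi> y))"
        using lborel_pair.AE_integrable_snd[of "\<lambda>y z. inner (\<psi> (y + z)) (\<psi> y)"] iA2
          lborel_pair.AE_integrable_snd[of "\<lambda>y z. inner (\<nu> * \<psi> (y + z)) (\<psi> y)"] iB2
        by simp_all
      then show "AE z in lborel. (LINT y|lborel. ?G y z) = cos (z * \<xi>) * A z - sin (z * \<xi>) * B z"
        by eventually_elim (simp add: G A_def B_def)
    qed measurable
    finally show ?thesis .
  qed
  let ?g = "\<lambda>\<xi>. exp (- (\<delta> * \<xi>)\<^sup>2 / 2)"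
  note ig = integrable_gauss[OF \<delta>]
  have iAB: "integrable lborel (\<lambda>z. norm (A z) + norm (B z))"
    using iA iB by auto
  \<comment> \<open>\<open>A\<close> and \<open>B\<close> are integrable in \<open>z\<close>; the
    Gaussian supplies integrability in \<xi>, so the two integrals may be interchanged.\<close>
  have "integrable (lborel \<Otimes>\<^sub>M lborel) (\<lambda>(\<xi>, z). ?g \<xi> * (norm (A z) + norm (B z)))"
  proof (rule integrableI_bounded)
    have "(\<integral>\<^sup>+ p. ennreal (norm (case p of (\<xi>, z) \<Rightarrow> ?g \<xi> * (norm (A z) + norm (B z)))) \<partial>(lborel \<Otimes>\<^sub>M lborel))
       = (\<integral>\<^sup>+ \<xi>. \<integral>\<^sup>+ z. ennreal (?g \<xi>) * ennreal (norm (norm (A z) + norm (B z))) \<partial>lborel \<partial>lborel)"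
      by (subst lborel.nn_integral_fst[symmetric]) (simp_all add: ennreal_mult' abs_mult)
    also have "\<dots> = (\<integral>\<^sup>+ \<xi>. ennreal (norm (?g \<xi>)) \<partial>lborel) * (\<integral>\<^sup>+ z. ennreal (norm (norm (A z) + norm (B z))) \<partial>lborel)"
      by (subst nn_integral_cmult, simp, subst nn_integral_multc) auto
    also have "\<dots> < \<infinity>"
      using ig iAB unfolding integrable_iff_bounded by (auto simp: ennreal_mult_less_top)
    finally show "(\<integral>\<^sup>+ p. ennreal (norm (case p of (\<xi>, z) \<Rightarrow> ?g \<xi> * (norm (A z) + norm (B z)))) \<partial>(lborel \<Otimes>\<^sub>M lborel)) < \<infinity>" .
  qed measurable
  then have iH: "integrable (lborel \<Otimes>\<^sub>M lborel)
      (\<lambda>(\<xi>, z). ?g \<xi> * (cos (z * \<xi>) * A z - sin (z * \<xi>) * B z))"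
  proof (rule Bochner_Integration.integrable_bound)
    show "AE p in lborel \<Otimes>\<^sub>M lborel.
      norm (case p of (\<xi>, z) \<Rightarrow> ?g \<xi> * (cos (z * \<xi>) * A z - sin (z * \<xi>) * B z))
      \<le> norm (case p of (\<xi>, z) \<Rightarrow> ?g \<xi> * (norm (A z) + norm (B z)))"
    proof (rule AE_I2, clarify)
      fix \<xi> z :: real
      have "\<bar>cos (z * \<xi>) * A z - sin (z * \<xi>) * B z\<bar> \<le> \<bar>cos (z * \<xi>)\<bar> * \<bar>A z\<bar> + \<bar>sin (z * \<xi>)\<bar> * \<bar>B z\<bar>"
        by (metis abs_mult abs_triangle_ineq4)
      also have "\<dots> \<le> \<bar>A z\<bar> + \<bar>B z\<bar>"
        by (intro add_mono mult_left_le_one_le) auto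
      finally show "norm (?g \<xi> * (cos (z * \<xi>) * A z - sin (z * \<xi>) * B z))
        \<le> norm (?g \<xi> * (norm (A z) + norm (B z)))"
        by (simp add: abs_mult)
    qed
  qed measurable
  have gF: "?g \<xi> * (norm (F \<xi>))\<^sup>2 = (LINT z|lborel. ?g \<xi> * (cos (z * \<xi>) * A z - sin (z * \<xi>) * B z))" for \<xi>
    by (simp add: F2)
  show "integrable lborel (\<lambda>\<xi>. ?g \<xi> * (norm (F \<xi>))\<^sup>2)"
    unfolding gF using lborel_pair.integrable_fst'[OF iH] by simp
  have igc: "integrable lborel (\<lambda>\<xi>. ?g \<xi> * cos (z * \<xi>))" "integrable lborel (\<lambda>\<xi>. ?g \<xi> * sin (z * \<xi>))" for z
    by (rule Bochner_Integration.integrable_bound[OF ig]; simp add: abs_mult)+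
  have "(LINT \<xi>|lborel. ?g \<xi> * (norm (F \<xi>))\<^sup>2)
     = (LINT z|lborel. LINT \<xi>|lborel. ?g \<xi> * (cos (z * \<xi>) * A z - sin (z * \<xi>) * B z))"
    unfolding gF using lborel_pair.Fubini_integral[OF iH] by simp
  also have "\<dots> = (LINT z|lborel. sqrt (2 * pi) / \<delta> * exp (- (z / \<delta>)\<^sup>2 / 2) * A z)"
  proof (rule Bochner_Integration.integral_cong)
    fix z
    have "(LINT \<xi>|lborel. ?g \<xi> * (cos (z * \<xi>) * A z - sin (z * \<xi>) * B z))
      = (LINT \<xi>|lborel. (?g \<xi> * cos (z * \<xi>)) * A z - (?g \<xi> * sin (z * \<xi>)) * B z)"
      by (simp add: algebra_simps)
    also have "\<dots> = (LINT \<xi>|lborel. (?g \<xi> * cos (z * \<xi>)) * A z) - (LINT \<xi>|lborel. (?g \<xi> * sin (z * \<xi>)) * B z)"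
      by (intro Bochner_Integration.integral_diff integrable_mult_left igc)
    also have "\<dots> = (LINT \<xi>|lborel. ?g \<xi> * cos (z * \<xi>)) * A z - (LINT \<xi>|lborel. ?g \<xi> * sin (z * \<xi>)) * B z"
      by simp
    finally show "(LINT \<xi>|lborel. ?g \<xi> * (cos (z * \<xi>) * A z - sin (z * \<xi>) * B z))
        = sqrt (2 * pi) / \<delta> * exp (- (z / \<delta>)\<^sup>2 / 2) * A z"
      by (simp only: integral_gauss_cos[OF \<delta>] integral_gauss_sin[OF \<delta>] mult_zero_left diff_zero)
  qed simp
  \<comment> \<open>Substituting z = \<delta> w moves \<delta> from the weight into the argument of
    \<open>A\<close>, where the limit \<delta> -> 0 becomes a question of continuity at 0.\<close>
  also have "\<dots> = sqrt (2 * pi) * (LINT w|lborel. exp (- w\<^sup>2 / 2) * A (\<delta> * w))"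
    using \<delta> by (subst lborel_integral_real_affine[where c=\<delta> and t=0]) (simp_all add: mult.assoc)
  finally show "(LINT \<xi>|lborel. ?g \<xi> * (norm (F \<xi>))\<^sup>2)
      = sqrt (2 * pi) * (LINT w|lborel. exp (- w\<^sup>2 / 2) * A (\<delta> * w))" .
qed

text \<open>Polarization: \<open>A z\<close> is the energy of \<psi> minus half the energy of the
  difference between \<psi> and its translate by \<open>z\<close>, so its limit at 0 follows from
  continuity of translations in L2. Square integrability makes the integral converge for every
  \<open>z\<close>; the uniform bound will dominate the Gaussian means.\<close>

lemma autocorrelation_tendsto:
  fixes \<psi> :: "real \<Rightarrow> 'b::euclidean_space"
  assumes [measurable]: "\<psi> \<in> borel_measurable borel" and \<psi>2: "integrable lborel (\<lambda>x. (norm (\<psi> x))\<^sup>2)"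
  defines "A \<equiv> \<lambda>z. LINT y|lborel. inner (\<psi> (y + z)) (\<psi> y)"
  shows "\<bar>A z\<bar> \<le> (LINT x|lborel. (norm (\<psi> x))\<^sup>2)"
    and "X \<longlonglongrightarrow> 0 \<Longrightarrow> (\<lambda>n. A (X n)) \<longlonglongrightarrow> (LINT x|lborel. (norm (\<psi> x))\<^sup>2)"
proof -
  let ?I = "LINT x|lborel. (norm (\<psi> x))\<^sup>2"
  note tr = integrable_lborel_translate[OF \<psi>2] integral_lborel_translate[OF \<psi>2]
  have am: "2 * \<bar>inner u v\<bar> \<le> (norm u)\<^sup>2 + (norm v)\<^sup>2" for u v :: 'b
    using Cauchy_Schwarz_ineq2[of u v] sum_squares_bound[of "norm u" "norm v"] by linarith
  have i: "integrable lborel (\<lambda>y. inner (\<psi> (y + z)) (\<psi> y))" for z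
    using Bochner_Integration.integrable_add[OF tr(1) \<psi>2]
  proof (rule Bochner_Integration.integrable_bound)
    show "AE y in lborel. norm (inner (\<psi> (y + z)) (\<psi> y)) \<le> norm ((norm (\<psi> (y + z)))\<^sup>2 + (norm (\<psi> y))\<^sup>2)"
      using am[of "\<psi> (_ + z)" "\<psi> _"] by (intro AE_I2) (auto intro: order_trans[OF _ am])
  qed measurable
  have "2 * \<bar>A z\<bar> \<le> (LINT y|lborel. 2 * \<bar>inner (\<psi> (y + z)) (\<psi> y)\<bar>)" for z
    unfolding A_def using integral_norm_bound[of lborel "\<lambda>y. inner (\<psi> (y + z)) (\<psi> y)"] by simp
  also have "\<dots> z \<le> (LINT y|lborel. (norm (\<psi> (y + z)))\<^sup>2 + (norm (\<psi> y))\<^sup>2)" for z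
    by (intro integral_mono am integrable_mult_right integrable_abs i
        Bochner_Integration.integrable_add[OF tr(1) \<psi>2])
  also have "\<dots> z = 2 * ?I" for z
    using tr \<psi>2 by simp
  finally show "\<bar>A z\<bar> \<le> ?I" by simp
  have eq: "A z = ?I - (LINT y|lborel. (norm (\<psi> (y + z) - \<psi> y))\<^sup>2) / 2" for z
  proof -
    have "(LINT y|lborel. (norm (\<psi> (y + z) - \<psi> y))\<^sup>2)
       = (LINT y|lborel. ((norm (\<psi> (y + z)))\<^sup>2 + (norm (\<psi> y))\<^sup>2) - 2 * inner (\<psi> (y + z)) (\<psi> y))"
      by (simp add: power2_norm_eq_inner inner_diff_left inner_diff_right inner_commute algebra_simps)
    also have "\<dots> = (LINT y|lborel. (norm (\<psi> (y + z)))\<^sup>2 + (norm (\<psi> y))\<^sup>2)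
         - (LINT y|lborel. 2 * inner (\<psi> (y + z)) (\<psi> y))"
      by (intro Bochner_Integration.integral_diff integrable_mult_right i
        Bochner_Integration.integrable_add[OF tr(1) \<psi>2])
    also have "\<dots> = 2 * ?I - 2 * A z"
      using tr \<psi>2 by (simp add: A_def)
    finally show ?thesis by linarith
  qed
  show "(\<lambda>n. A (X n)) \<longlonglongrightarrow> ?I" if "X \<longlonglongrightarrow> 0"
  proof -
    have "(\<lambda>n. ?I - (LINT y|lborel. (norm (\<psi> (y + X n) - \<psi> y))\<^sup>2) / 2) \<longlonglongrightarrow> ?I - 0 / 2"
      using that by (intro tendsto_diff tendsto_divide tendsto_const L2_translation_tendsto \<psi>2) auto
    then show ?thesis by (simp add: eq)
  qed
qed

text \<open>The limit of the regularized energies is computed twice: by dominated convergence on the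
  autocorrelation side, and by monotone convergence on the side of the transform. Stated in
  \<open>ennreal\<close>, the identity includes the finiteness of the energy of the
  transform.\<close>

theorem plancherel_qexp:
  fixes \<psi> :: "real \<Rightarrow> quat"
  assumes \<nu>: "\<nu>\<^sup>2 = -1" and \<psi>: "integrable lborel \<psi>" and \<psi>2: "integrable lborel (\<lambda>x. (norm (\<psi> x))\<^sup>2)"
  shows "(\<integral>\<^sup>+ \<xi>. ennreal ((norm (LINT x|lborel. qexp \<nu> (- (x * \<xi>)) * \<psi> x))\<^sup>2) \<partial>lborel)
    = ennreal (2 * pi * (LINT x|lborel. (norm (\<psi> x))\<^sup>2))"
proof -
  let ?I = "LINT x|lborel. (norm (\<psi> x))\<^sup>2"
  define F where "F \<xi> = (LINT x|lborel. qexp \<nu> (- (x * \<xi>)) * \<psi> x)" for \<xi>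
  define A where "A z = (LINT y|lborel. inner (\<psi> (y + z)) (\<psi> y))" for z
  \<comment> \<open>The widths decrease to 0, so the Gaussian weights increase to 1 as monotone
    convergence requires.\<close>
  define d where "d n = 1 / real (Suc n)" for n
  have d0: "0 < d n" for n by (simp add: d_def)
  have dlim: "d \<longlonglongrightarrow> 0"
    unfolding d_def[abs_def] using LIMSEQ_inverse_real_of_nat by (simp add: inverse_eq_divide)
  have dmono: "d (Suc n) \<le> d n" for n by (simp add: d_def frac_le)
  have [measurable]: "\<psi> \<in> borel_measurable borel" using \<psi> by auto
  have [measurable]: "F \<in> borel_measurable borel" "A \<in> borel_measurable borel"
    unfolding F_def[abs_def] A_def[abs_def] by measurable
  note reg = gauss_regularized_plancherel[OF \<nu> \<psi> d0, folded F_def A_def]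
  have "(\<lambda>n. LINT w|lborel. exp (- w\<^sup>2 / 2) * A (d n * w)) \<longlonglongrightarrow> (LINT w|lborel. exp (- w\<^sup>2 / 2) * ?I)"
  proof (rule integral_dominated_convergence[where w="\<lambda>w. exp (- w\<^sup>2 / 2) * ?I"])
    show "integrable lborel (\<lambda>w. exp (- w\<^sup>2 / 2) * ?I)"
      using integrable_mult_left[OF integrable_gauss[of 1], of ?I] by simp
    have "(\<lambda>n. exp (- w\<^sup>2 / 2) * A (d n * w)) \<longlonglongrightarrow> exp (- w\<^sup>2 / 2) * ?I" for w
    proof -
      have "(\<lambda>n. d n * w) \<longlonglongrightarrow> 0" using dlim by (rule tendsto_mult_left_zero)
      then show ?thesis
        unfolding A_def
        by (intro tendsto_mult tendsto_const autocorrelation_tendsto(2)[OF _ \<psi>2]) measurable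
    qed
    then show "AE w in lborel. (\<lambda>n. exp (- w\<^sup>2 / 2) * A (d n * w)) \<longlonglongrightarrow> exp (- w\<^sup>2 / 2) * ?I"
      by simp
    show "AE w in lborel. norm (exp (- w\<^sup>2 / 2) * A (d n * w)) \<le> exp (- w\<^sup>2 / 2) * ?I" for n
      unfolding A_def
      by (intro AE_I2) (simp add: abs_mult autocorrelation_tendsto(1)[OF _ \<psi>2])
  qed measurable
  then have "(\<lambda>n. sqrt (2 * pi) * (LINT w|lborel. exp (- w\<^sup>2 / 2) * A (d n * w)))
      \<longlonglongrightarrow> sqrt (2 * pi) * (LINT w|lborel. exp (- w\<^sup>2 / 2) * ?I)"
    by (rule tendsto_mult_left)
  \<comment> \<open>One factor sqrt (2 pi) comes from the regularized identity, the other is the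
    total mass of the Gaussian weight.\<close>
  also have "sqrt (2 * pi) * (LINT w|lborel. exp (- w\<^sup>2 / 2) * ?I) = 2 * pi * ?I"
    using integral_gauss_cos[of 1 0] by simp
  finally have "(\<lambda>n. ennreal (LINT \<xi>|lborel. exp (- (d n * \<xi>)\<^sup>2 / 2) * (norm (F \<xi>))\<^sup>2)) \<longlonglongrightarrow> ennreal (2 * pi * ?I)"
    unfolding reg(2)[symmetric] by (intro tendsto_ennrealI)
  then have 1: "(\<lambda>n. \<integral>\<^sup>+\<xi>. ennreal (exp (- (d n * \<xi>)\<^sup>2 / 2) * (norm (F \<xi>))\<^sup>2) \<partial>lborel) \<longlonglongrightarrow> ennreal (2 * pi * ?I)"
    by (subst nn_integral_eq_integral[OF reg(1)]) auto
  have 2: "(\<lambda>n. \<integral>\<^sup>+\<xi>. ennreal (exp (- (d n * \<xi>)\<^sup>2 / 2) * (norm (F \<xi>))\<^sup>2) \<partial>lborel)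
      \<longlonglongrightarrow> (\<integral>\<^sup>+\<xi>. ennreal ((norm (F \<xi>))\<^sup>2) \<partial>lborel)"
  proof (rule nn_integral_LIMSEQ)
    show "incseq (\<lambda>n \<xi>. ennreal (exp (- (d n * \<xi>)\<^sup>2 / 2) * (norm (F \<xi>))\<^sup>2))"
    proof (rule incseq_SucI, rule le_funI, rule ennreal_leI, rule mult_right_mono)
      fix n \<xi>
      have "(d (Suc n) * \<xi>)\<^sup>2 \<le> (d n * \<xi>)\<^sup>2"
        unfolding power_mult_distrib using dmono[of n] d0[of "Suc n"]
        by (intro mult_right_mono power_mono) auto
      then show "exp (- (d n * \<xi>)\<^sup>2 / 2) \<le> exp (- (d (Suc n) * \<xi>)\<^sup>2 / 2)" by simp
    qed simp
    fix \<xi>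
    have "(\<lambda>n. exp (- (d n * \<xi>)\<^sup>2 / 2) * (norm (F \<xi>))\<^sup>2) \<longlonglongrightarrow> exp (- (0 * \<xi>)\<^sup>2 / 2) * (norm (F \<xi>))\<^sup>2"
      by (intro tendsto_intros dlim) auto
    then show "(\<lambda>n. ennreal (exp (- (d n * \<xi>)\<^sup>2 / 2) * (norm (F \<xi>))\<^sup>2)) \<longlonglongrightarrow> ennreal ((norm (F \<xi>))\<^sup>2)"
      by (intro tendsto_ennrealI) simp
  qed measurable
  show ?thesis
    using LIMSEQ_unique[OF 2 1] by (simp add: F_def)
qed

section \<open>The one-dimensional offset linear canonical transform\<close>

lemma norm_qsqrt_power2:
  assumes "\<nu>\<^sup>2 = -1"
  shows "(norm (qsqrt \<nu> r))\<^sup>2 = \<bar>r\<bar>"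
  using norm_quat_imaginary_unit[OF assms] by (simp add: qsqrt_def norm_mult)

lemma qcnj_qexp: "qcnj (qexp \<nu> a) = qexp (- \<nu>) a" if "\<nu>\<^sup>2 = -1"
  using quat_imaginary_unit(1)[OF that]
  by (simp add: qexp_def qcnj_def of_real_quat quat_eq_iff)

lemma qcnj_mult: "qcnj (p * q) = qcnj q * qcnj p"
  by (simp add: qcnj_def quat_eq_iff algebra_simps)

lemma norm_qcnj [simp]: "norm (qcnj q) = norm q"
  by (simp add: norm_quat_def qcnj_def)

text \<open>Boundedness lets conjugation pass through the Bochner integral.\<close>

lemma bounded_linear_qcnj: "bounded_linear qcnj"
  by (rule bounded_linear_intro[where K=1]) (simp_all add: qcnj_def quat_eq_iff norm_quat_def)

lemma borel_measurable_qcnj [measurable (raw)]: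
  "h \<in> borel_measurable M \<Longrightarrow> (\<lambda>x. qcnj (h x)) \<in> borel_measurable M"
  by (rule borel_measurable_continuous_on[OF linear_continuous_on[OF bounded_linear_qcnj]])

text \<open>The phase in \<open>x\<close> preserves the modulus and is absorbed into \<phi>. The
  phase in \<open>y\<close> leaves the integral on the left, since exponentials of one \<nu> commute
  with each other. What remains is the Fourier integral at y / b, and the substitution \<xi> = y / b
  contributes |b|.\<close>

lemma plancherel_chirp:
  fixes \<phi> :: "real \<Rightarrow> quat"
  assumes \<nu>: "\<nu>\<^sup>2 = -1" and b: "b \<noteq> 0" and [measurable]: "\<alpha> \<in> borel_measurable borel" "\<phi> \<in> borel_measurable borel"
    and \<phi>: "(\<integral>\<^sup>+x. ennreal (norm (\<phi> x)) \<partial>lborel) < \<infinity>" "(\<integral>\<^sup>+x. ennreal ((norm (\<phi> x))\<^sup>2) \<partial>lborel) < \<infinity>"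
  shows "(\<integral>\<^sup>+ y. ennreal ((norm (LINT x|lborel. qexp \<nu> (\<alpha> x + \<beta> y - x * y / b) * \<phi> x))\<^sup>2) \<partial>lborel)
    = ennreal (2 * pi * \<bar>b\<bar>) * (\<integral>\<^sup>+x. ennreal ((norm (\<phi> x))\<^sup>2) \<partial>lborel)"
proof -
  define \<psi> where "\<psi> x = qexp \<nu> (\<alpha> x) * \<phi> x" for x
  have [measurable]: "\<psi> \<in> borel_measurable borel"
    unfolding \<psi>_def by measurable
  have n\<psi>: "norm (\<psi> x) = norm (\<phi> x)" for x
    by (simp add: \<psi>_def norm_mult norm_qexp[OF \<nu>])
  have \<psi>: "integrable lborel \<psi>" "integrable lborel (\<lambda>x. (norm (\<psi> x))\<^sup>2)"
    using \<phi> by (simp_all add: integrable_iff_bounded n\<psi>)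
  define F where "F \<xi> = (LINT x|lborel. qexp \<nu> (- (x * \<xi>)) * \<psi> x)" for \<xi>
  have [measurable]: "F \<in> borel_measurable borel"
    unfolding F_def[abs_def] by measurable
  have i: "integrable lborel (\<lambda>x. qexp \<nu> (- (x * \<xi>)) * \<psi> x)" for \<xi>
    by (rule Bochner_Integration.integrable_bound[OF \<psi>(1)]) (auto simp: norm_mult norm_qexp[OF \<nu>])
  have "norm (LINT x|lborel. qexp \<nu> (\<alpha> x + \<beta> y - x * y / b) * \<phi> x) = norm (F (y / b))" for y
  proof -
    have "qexp \<nu> (\<alpha> x + \<beta> y - x * y / b) * \<phi> x = qexp \<nu> (\<beta> y) * (qexp \<nu> (- (x * (y / b))) * \<psi> x)" for x
    proof -
      have "\<alpha> x + \<beta> y - x * y / b = \<beta> y + (- (x * (y / b)) + \<alpha> x)" by simp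
      then show ?thesis by (simp only: qexp_add[OF \<nu>] \<psi>_def mult.assoc)
    qed
    then show ?thesis
      using i[of "y / b"] by (simp add: F_def norm_mult norm_qexp[OF \<nu>])
  qed
  then have "(\<integral>\<^sup>+ y. ennreal ((norm (LINT x|lborel. qexp \<nu> (\<alpha> x + \<beta> y - x * y / b) * \<phi> x))\<^sup>2) \<partial>lborel)
      = (\<integral>\<^sup>+ y. ennreal ((norm (F (y / b)))\<^sup>2) \<partial>lborel)"
    by simp
  also have "\<dots> = ennreal \<bar>b\<bar> * (\<integral>\<^sup>+ \<xi>. ennreal ((norm (F \<xi>))\<^sup>2) \<partial>lborel)"
    using b by (subst nn_integral_real_affine[where c=b and t=0]) simp_all
  also have "\<dots> = ennreal \<bar>b\<bar> * (ennreal (2 * pi) * ennreal (LINT x|lborel. (norm (\<psi> x))\<^sup>2))"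
    unfolding F_def plancherel_qexp[OF \<nu> \<psi>] by (simp add: ennreal_mult)
  also have "ennreal (LINT x|lborel. (norm (\<psi> x))\<^sup>2) = (\<integral>\<^sup>+x. ennreal ((norm (\<phi> x))\<^sup>2) \<partial>lborel)"
    by (subst nn_integral_eq_integral[symmetric, OF \<psi>(2)]) (simp_all add: n\<psi>)
  finally show ?thesis
    by (simp add: ennreal_mult ac_simps)
qed

lemma norm_olct_kernel:
  assumes "\<nu>\<^sup>2 = -1"
  shows "(norm (olct_kernel \<nu> A x y))\<^sup>2 = 1 / (2 * pi * \<bar>pb A\<bar>)"
proof -
  have "(norm (olct_kernel \<nu> A x y))\<^sup>2 = inverse ((norm (qsqrt \<nu> (2 * pi * pb A)))\<^sup>2)"
    by (simp only: olct_kernel_def norm_mult norm_inverse norm_qexp[OF assms] power_inverse mult_1_left mult_1_right)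
  also have "\<dots> = inverse (2 * pi * \<bar>pb A\<bar>)"
    by (simp only: norm_qsqrt_power2[OF assms] abs_mult) simp
  finally show ?thesis by (simp only: inverse_eq_divide)
qed

text \<open>Only the term - 2 x y of the exponent couples the variables, and division by 2 b makes
  it - x y / b. The squared modulus of the constant is what cancels the factor 2 pi |b| of
  \<open>plancherel_chirp\<close>.\<close>

lemma olct_kernel_phase:
  assumes \<nu>: "\<nu>\<^sup>2 = -1" and b: "pb A \<noteq> 0"
  obtains C \<alpha> \<beta> where "(norm C)\<^sup>2 = 1 / (2 * pi * \<bar>pb A\<bar>)"
    "\<alpha> \<in> borel_measurable borel" "\<beta> \<in> borel_measurable borel"
    "\<And>x y. olct_kernel \<nu> A x y = C * qexp \<nu> (\<alpha> x + \<beta> y - x * y / pb A)"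
proof
  let ?C = "qexp \<nu> (- pi / 4) * inverse (qsqrt \<nu> (2 * pi * pb A))"
  let ?\<alpha> = "\<lambda>x. (pa A * x\<^sup>2 + 2 * x * p\<tau> A) / (2 * pb A)"
  let ?\<beta> = "\<lambda>y. (- 2 * y * (pd A * p\<tau> A - pb A * p\<eta> A) + pd A * (y\<^sup>2 + (p\<tau> A)\<^sup>2)) / (2 * pb A)"
  show "?\<alpha> \<in> borel_measurable borel" "?\<beta> \<in> borel_measurable borel"
    by (measurable, measurable)
  show K: "olct_kernel \<nu> A x y = ?C * qexp \<nu> (?\<alpha> x + ?\<beta> y - x * y / pb A)" for x y
    unfolding olct_kernel_def using b
    by (intro arg_cong[where f="\<lambda>t. _ * qexp \<nu> t"]) (simp add: field_simps)
  show "(norm ?C)\<^sup>2 = 1 / (2 * pi * \<bar>pb A\<bar>)"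
    using norm_olct_kernel[OF \<nu>, of A 0 0] unfolding K norm_mult[of ?C] by (simp only: norm_qexp[OF \<nu>] mult_1_right)
qed

lemma borel_measurable_olct_kernel [measurable (raw)]:
  assumes [measurable]: "f \<in> borel_measurable M" "g \<in> borel_measurable M"
  shows "(\<lambda>z. olct_kernel \<nu> A (f z) (g z)) \<in> borel_measurable M"
  unfolding olct_kernel_def by measurable

lemma olct_plancherel_left:
  fixes \<phi> :: "real \<Rightarrow> quat"
  assumes \<nu>: "\<nu>\<^sup>2 = -1" and b: "pb A \<noteq> 0" and [measurable]: "\<phi> \<in> borel_measurable borel"
    and \<phi>: "(\<integral>\<^sup>+x. ennreal (norm (\<phi> x)) \<partial>lborel) < \<infinity>" "(\<integral>\<^sup>+x. ennreal ((norm (\<phi> x))\<^sup>2) \<partial>lborel) < \<infinity>"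
  shows "(\<integral>\<^sup>+ y. ennreal ((norm (LINT x|lborel. olct_kernel \<nu> A x y * \<phi> x))\<^sup>2) \<partial>lborel)
    = (\<integral>\<^sup>+x. ennreal ((norm (\<phi> x))\<^sup>2) \<partial>lborel)"
proof -
  obtain C \<alpha> \<beta> where C': "(norm C)\<^sup>2 = 1 / (2 * pi * \<bar>pb A\<bar>)"
    and [measurable]: "\<alpha> \<in> borel_measurable borel" "\<beta> \<in> borel_measurable borel"
    and K: "\<And>x y. olct_kernel \<nu> A x y = C * qexp \<nu> (\<alpha> x + \<beta> y - x * y / pb A)"
    by (rule olct_kernel_phase[OF \<nu> b], rule that)
  have C: "(norm C)\<^sup>2 * (2 * pi * \<bar>pb A\<bar>) = 1" using b by (simp add: C')
  have i\<phi>: "integrable lborel \<phi>" using \<phi> by (simp add: integrable_iff_bounded)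
  have i: "integrable lborel (\<lambda>x. qexp \<nu> (\<alpha> x + \<beta> y - x * y / pb A) * \<phi> x)" for y
    by (rule Bochner_Integration.integrable_bound[OF i\<phi>]) (auto simp: norm_mult norm_qexp[OF \<nu>])
  let ?J = "\<lambda>y. LINT x|lborel. qexp \<nu> (\<alpha> x + \<beta> y - x * y / pb A) * \<phi> x"
  have "(norm (LINT x|lborel. olct_kernel \<nu> A x y * \<phi> x))\<^sup>2 = (norm C)\<^sup>2 * (norm (?J y))\<^sup>2" for y
    using i[of y] by (simp add: K mult.assoc norm_mult power_mult_distrib)
  then have "(\<integral>\<^sup>+ y. ennreal ((norm (LINT x|lborel. olct_kernel \<nu> A x y * \<phi> x))\<^sup>2) \<partial>lborel)
     = (\<integral>\<^sup>+ y. ennreal ((norm C)\<^sup>2) * ennreal ((norm (?J y))\<^sup>2) \<partial>lborel)"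
    by (simp add: ennreal_mult)
  also have "\<dots> = ennreal ((norm C)\<^sup>2) * (\<integral>\<^sup>+ y. ennreal ((norm (?J y))\<^sup>2) \<partial>lborel)"
    by (rule nn_integral_cmult) measurable
  also have "\<dots> = ennreal ((norm C)\<^sup>2) * (ennreal (2 * pi * \<bar>pb A\<bar>) * (\<integral>\<^sup>+x. ennreal ((norm (\<phi> x))\<^sup>2) \<partial>lborel))"
    by (subst plancherel_chirp[OF \<nu> b _ _ \<phi>]) auto
  also have "\<dots> = ennreal ((norm C)\<^sup>2 * (2 * pi * \<bar>pb A\<bar>)) * (\<integral>\<^sup>+x. ennreal ((norm (\<phi> x))\<^sup>2) \<partial>lborel)"
    by (subst ennreal_mult) (auto simp: mult.assoc)
  finally show ?thesis by (simp add: C)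
qed

text \<open>Conjugation turns right multiplication by the kernel of \<open>\<nu>\<close> into left multiplication by \<open>qexp (- \<nu>)\<close>.\<close>

lemma olct_plancherel_right:
  fixes \<phi> :: "real \<Rightarrow> quat"
  assumes \<nu>: "\<nu>\<^sup>2 = -1" and b: "pb A \<noteq> 0" and [measurable]: "\<phi> \<in> borel_measurable borel"
    and \<phi>: "(\<integral>\<^sup>+x. ennreal (norm (\<phi> x)) \<partial>lborel) < \<infinity>" "(\<integral>\<^sup>+x. ennreal ((norm (\<phi> x))\<^sup>2) \<partial>lborel) < \<infinity>"
  shows "(\<integral>\<^sup>+ y. ennreal ((norm (LINT x|lborel. \<phi> x * olct_kernel \<nu> A x y))\<^sup>2) \<partial>lborel)
    = (\<integral>\<^sup>+x. ennreal ((norm (\<phi> x))\<^sup>2) \<partial>lborel)"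
proof -
  obtain C \<alpha> \<beta> where C': "(norm C)\<^sup>2 = 1 / (2 * pi * \<bar>pb A\<bar>)"
    and [measurable]: "\<alpha> \<in> borel_measurable borel" "\<beta> \<in> borel_measurable borel"
    and K: "\<And>x y. olct_kernel \<nu> A x y = C * qexp \<nu> (\<alpha> x + \<beta> y - x * y / pb A)"
    by (rule olct_kernel_phase[OF \<nu> b], rule that)
  have C: "2 * pi * \<bar>pb A\<bar> * (norm C)\<^sup>2 = 1" using b by (simp add: C')
  have \<nu>': "(- \<nu>)\<^sup>2 = -1" using \<nu> by simp
  \<comment> \<open>The constant \<open>C\<close> sits between \<phi> and the exponential and cannot
    be moved past \<phi>, so it is merged into \<phi> before conjugating.\<close>
  define \<psi> where "\<psi> x = qcnj (\<phi> x * C)" for x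
  have [measurable]: "\<psi> \<in> borel_measurable borel" unfolding \<psi>_def by measurable
  have n\<psi>: "norm (\<psi> x) = norm C * norm (\<phi> x)" for x by (simp add: \<psi>_def norm_mult)
  have n1: "(\<integral>\<^sup>+x. ennreal (norm (\<psi> x)) \<partial>lborel) = ennreal (norm C) * (\<integral>\<^sup>+x. ennreal (norm (\<phi> x)) \<partial>lborel)"
    by (simp add: n\<psi> ennreal_mult nn_integral_cmult)
  have n2: "(\<integral>\<^sup>+x. ennreal ((norm (\<psi> x))\<^sup>2) \<partial>lborel)
      = ennreal ((norm C)\<^sup>2) * (\<integral>\<^sup>+x. ennreal ((norm (\<phi> x))\<^sup>2) \<partial>lborel)"
    by (simp add: n\<psi> ennreal_mult nn_integral_cmult power_mult_distrib)
  have \<psi>: "(\<integral>\<^sup>+x. ennreal (norm (\<psi> x)) \<partial>lborel) < \<infinity>" "(\<integral>\<^sup>+x. ennreal ((norm (\<psi> x))\<^sup>2) \<partial>lborel) < \<infinity>"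
    unfolding n1 n2 using \<phi> by (auto simp: ennreal_mult_less_top)
  have i\<phi>: "integrable lborel \<phi>" using \<phi> by (simp add: integrable_iff_bounded)
  have i: "integrable lborel (\<lambda>x. \<phi> x * olct_kernel \<nu> A x y)" for y
  proof (rule Bochner_Integration.integrable_bound[OF integrable_mult_right[OF integrable_norm[OF i\<phi>], of "norm C"]])
    show "AE x in lborel. norm (\<phi> x * olct_kernel \<nu> A x y) \<le> norm (norm C * norm (\<phi> x))"
      by (simp add: K norm_mult norm_qexp[OF \<nu>] mult.commute)
  qed measurable
  have "norm (LINT x|lborel. \<phi> x * olct_kernel \<nu> A x y)
      = norm (LINT x|lborel. qexp (- \<nu>) (\<alpha> x + \<beta> y - x * y / pb A) * \<psi> x)" for y
  proof -
    have "norm (LINT x|lborel. \<phi> x * olct_kernel \<nu> A x y)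
       = norm (LINT x|lborel. qcnj (\<phi> x * olct_kernel \<nu> A x y))"
      using integral_bounded_linear[OF bounded_linear_qcnj i[of y]] by simp
    also have "(\<lambda>x. qcnj (\<phi> x * olct_kernel \<nu> A x y))
        = (\<lambda>x. qexp (- \<nu>) (\<alpha> x + \<beta> y - x * y / pb A) * \<psi> x)"
      by (simp only: K \<psi>_def qcnj_mult qcnj_qexp[OF \<nu>] mult.assoc)
    finally show ?thesis .
  qed
  then have "(\<integral>\<^sup>+ y. ennreal ((norm (LINT x|lborel. \<phi> x * olct_kernel \<nu> A x y))\<^sup>2) \<partial>lborel)
     = ennreal (2 * pi * \<bar>pb A\<bar>) * (\<integral>\<^sup>+x. ennreal ((norm (\<psi> x))\<^sup>2) \<partial>lborel)"
    by (simp add: plancherel_chirp[OF \<nu>' b _ _ \<psi>])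
  also have "\<dots> = ennreal (2 * pi * \<bar>pb A\<bar> * (norm C)\<^sup>2) * (\<integral>\<^sup>+x. ennreal ((norm (\<phi> x))\<^sup>2) \<partial>lborel)"
    unfolding n2 by (subst ennreal_mult) (auto simp: mult.assoc)
  finally show ?thesis by (simp only: C) simp
qed

section \<open>Plancherel theorem for the two-sided transform\<close>

lemma integral_lebesgue_borel:
  fixes f :: "'a::euclidean_space \<Rightarrow> 'b::{banach, second_countable_topology}"
  assumes "f \<in> borel_measurable borel"
  shows "(LINT x|lebesgue. f x) = (LINT x|lborel. f x)"
  using assms by (intro integral_completion) simp

lemma borel_measurable_olct_chirp [measurable (raw)]:
  assumes [measurable]: "f \<in> borel_measurable M"
  shows "(\<lambda>z. olct_chirp \<nu> A (f z)) \<in> borel_measurable M"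
  unfolding olct_chirp_def by measurable

lemma norm_olct_chirp: "\<nu>\<^sup>2 = -1 \<Longrightarrow> norm (olct_chirp \<nu> A y) = 1"
  by (simp add: olct_chirp_def norm_qexp)

lemma norm_olct_kernel':
  assumes "\<nu>\<^sup>2 = -1"
  shows "norm (olct_kernel \<nu> A x y) = sqrt (1 / (2 * pi * \<bar>pb A\<bar>))"
  unfolding norm_olct_kernel[OF assms, of A x y, symmetric] by simp

text \<open>Outside the integrable case the Bochner integral is 0, so the bound can be used before
  the integrability of a partial transform is known.\<close>

lemma norm_integral_le_nn_integral:
  "ennreal (norm (LINT x|M. f x)) \<le> (\<integral>\<^sup>+x. ennreal (norm (f x)) \<partial>M)"
  by (cases "integrable M f") (auto simp: not_integrable_integral_eq intro: integral_norm_bound_ennreal)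

lemma
  fixes f :: "'a::euclidean_space \<times> 'b::euclidean_space \<Rightarrow> ennreal"
  assumes [measurable]: "f \<in> borel_measurable (borel \<Otimes>\<^sub>M borel)"
    and f: "(\<integral>\<^sup>+p. f p \<partial>(lborel \<Otimes>\<^sub>M lborel)) < \<infinity>"
  shows AE_nn_integral_fst_finite: "AE x in lborel. (\<integral>\<^sup>+y. f (x, y) \<partial>lborel) < \<infinity>"
    and AE_nn_integral_snd_finite: "AE y in lborel. (\<integral>\<^sup>+x. f (x, y) \<partial>lborel) < \<infinity>"
proof -
  have "AE x in lborel. (\<integral>\<^sup>+y. f (x, y) \<partial>lborel) \<noteq> \<infinity>"
    by (rule nn_integral_PInf_AE) (use f in \<open>simp_all add: lborel.nn_integral_fst\<close>)
  then show "AE x in lborel. (\<integral>\<^sup>+y. f (x, y) \<partial>lborel) < \<infinity>"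
    by (simp add: less_top)
  have "AE y in lborel. (\<integral>\<^sup>+x. f (x, y) \<partial>lborel) \<noteq> \<infinity>"
    by (rule nn_integral_PInf_AE) (use f in \<open>simp_all add: lborel_pair.nn_integral_snd\<close>)
  then show "AE y in lborel. (\<integral>\<^sup>+x. f (x, y) \<partial>lborel) < \<infinity>"
    by (simp add: less_top)
qed

text \<open>For Borel \<open>h\<close> the completed measure can be replaced by a product of two
  copies of \<open>lborel\<close>, the form to which Fubini applies.\<close>

lemma qolct_borel:
  assumes [measurable]: "h \<in> borel_measurable (borel \<Otimes>\<^sub>M borel)"
  shows "qolct \<kappa> \<mu> A1 A2 h u =
    (if pb A1 \<noteq> 0 \<and> pb A2 \<noteq> 0 then
       (LINT s|(lborel \<Otimes>\<^sub>M lborel). olct_kernel \<kappa> A1 (fst s) (fst u) * h s * olct_kernel \<mu> A2 (snd s) (snd u))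
     else if pb A1 = 0 \<and> pb A2 \<noteq> 0 then
       (LINT s2|lborel. qsqrt \<kappa> (pd A1) * olct_chirp \<kappa> A1 (fst u) *
          h (pd A1 * (fst u - p\<tau> A1), s2) * olct_kernel \<mu> A2 s2 (snd u))
     else if pb A1 \<noteq> 0 \<and> pb A2 = 0 then
       (LINT s1|lborel. qsqrt \<mu> (pd A2) * olct_kernel \<kappa> A1 s1 (fst u) *
          h (s1, pd A2 * (snd u - p\<tau> A2)) * olct_chirp \<mu> A2 (snd u))
     else
       qsqrt \<kappa> (pd A1 * pd A2) * olct_chirp \<kappa> A1 (fst u) *
          h (pd A1 * (fst u - p\<tau> A1), pd A2 * (snd u - p\<tau> A2)) * olct_chirp \<mu> A2 (snd u))"
proof -
  have 1: "(\<lambda>s. olct_kernel \<kappa> A1 (fst s) (fst u) * h s * olct_kernel \<mu> A2 (snd s) (snd u)) \<in> borel_measurable borel"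
    unfolding borel_prod[symmetric] by measurable
  have 2: "(\<lambda>s2. qsqrt \<kappa> (pd A1) * olct_chirp \<kappa> A1 (fst u) *
          h (pd A1 * (fst u - p\<tau> A1), s2) * olct_kernel \<mu> A2 s2 (snd u)) \<in> borel_measurable borel"
    by measurable
  have 3: "(\<lambda>s1. qsqrt \<mu> (pd A2) * olct_kernel \<kappa> A1 s1 (fst u) *
          h (s1, pd A2 * (snd u - p\<tau> A2)) * olct_chirp \<mu> A2 (snd u)) \<in> borel_measurable borel"
    by measurable
  show ?thesis
    unfolding qolct_def integral_lebesgue_borel[OF 1] integral_lebesgue_borel[OF 2]
      integral_lebesgue_borel[OF 3] lborel_prod ..
qed

lemma borel_measurable_qolct:
  assumes [measurable]: "h \<in> borel_measurable (borel \<Otimes>\<^sub>M borel)"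
  shows "qolct \<kappa> \<mu> A1 A2 h \<in> borel_measurable (borel \<Otimes>\<^sub>M borel)"
  unfolding qolct_borel[OF assms, abs_def] by measurable

text \<open>The kernels act on opposite sides, so by associativity the transform in the first
  variable can be completed before the one in the second. Each stage is one-dimensional Plancherel
  on almost every section, and Tonelli changes the direction of the sections in between.\<close>

lemma qolct_plancherel_both:
  assumes \<kappa>: "\<kappa>\<^sup>2 = -1" and \<mu>: "\<mu>\<^sup>2 = -1" and b: "pb A1 \<noteq> 0" "pb A2 \<noteq> 0"
    and [measurable]: "h \<in> borel_measurable (borel \<Otimes>\<^sub>M borel)"
    and h: "(\<integral>\<^sup>+s. ennreal (norm (h s)) \<partial>(lborel \<Otimes>\<^sub>M lborel)) < \<infinity>"
      "(\<integral>\<^sup>+s. ennreal ((norm (h s))\<^sup>2) \<partial>(lborel \<Otimes>\<^sub>M lborel)) < \<infinity>"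
  shows "(\<integral>\<^sup>+u. ennreal ((norm (LINT s|(lborel \<Otimes>\<^sub>M lborel).
      olct_kernel \<kappa> A1 (fst s) (fst u) * h s * olct_kernel \<mu> A2 (snd s) (snd u)))\<^sup>2) \<partial>(lborel \<Otimes>\<^sub>M lborel))
    = (\<integral>\<^sup>+s. ennreal ((norm (h s))\<^sup>2) \<partial>(lborel \<Otimes>\<^sub>M lborel))"
proof -
  \<comment> \<open>\<open>G\<close> is the half-way stage: \<open>x\<close> is already the
    transformed first variable, \<open>y\<close> is still the original second one.\<close>
  define G where "G x y = (LINT s|lborel. olct_kernel \<kappa> A1 s x * h (s, y))" for x y
  have mG[measurable]: "(\<lambda>p. G (fst p) (snd p)) \<in> borel_measurable (borel \<Otimes>\<^sub>M borel)"
    unfolding G_def by measurable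
  have mG1[measurable]: "G x \<in> borel_measurable borel" for x
    unfolding G_def by measurable
  have h': "(\<integral>\<^sup>+y. \<integral>\<^sup>+x. ennreal (norm (h (x, y))) \<partial>lborel \<partial>lborel) < \<infinity>"
    using h lborel_pair.nn_integral_snd[of "\<lambda>s. ennreal (norm (h s))"] by simp
  have "AE y in lborel. (\<integral>\<^sup>+x. ennreal (norm (h (x, y))) \<partial>lborel) < \<infinity>"
      "AE y in lborel. (\<integral>\<^sup>+x. ennreal ((norm (h (x, y)))\<^sup>2) \<partial>lborel) < \<infinity>"
    using h by (auto intro!: AE_nn_integral_snd_finite simp del: infinity_ennreal_def)
  then have "AE y in lborel. (\<integral>\<^sup>+x. ennreal ((norm (G x y))\<^sup>2) \<partial>lborel)
      = (\<integral>\<^sup>+x. ennreal ((norm (h (x, y)))\<^sup>2) \<partial>lborel)"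
    by eventually_elim
      (auto simp: G_def intro!: olct_plancherel_left[OF \<kappa> b(1)])
  then have "(\<integral>\<^sup>+y. \<integral>\<^sup>+x. ennreal ((norm (G x y))\<^sup>2) \<partial>lborel \<partial>lborel)
      = (\<integral>\<^sup>+y. \<integral>\<^sup>+x. ennreal ((norm (h (x, y)))\<^sup>2) \<partial>lborel \<partial>lborel)"
    by (rule nn_integral_cong_AE)
  also have "\<dots> = (\<integral>\<^sup>+s. ennreal ((norm (h s))\<^sup>2) \<partial>(lborel \<Otimes>\<^sub>M lborel))"
    by (rule lborel_pair.nn_integral_snd) measurable
  also have "(\<integral>\<^sup>+y. \<integral>\<^sup>+x. ennreal ((norm (G x y))\<^sup>2) \<partial>lborel \<partial>lborel)
      = (\<integral>\<^sup>+x. \<integral>\<^sup>+y. ennreal ((norm (G x y))\<^sup>2) \<partial>lborel \<partial>lborel)"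
    by (rule lborel_pair.Fubini') (simp add: case_prod_beta')
  finally have G2: "(\<integral>\<^sup>+x. \<integral>\<^sup>+y. ennreal ((norm (G x y))\<^sup>2) \<partial>lborel \<partial>lborel)
      = (\<integral>\<^sup>+s. ennreal ((norm (h s))\<^sup>2) \<partial>(lborel \<Otimes>\<^sub>M lborel))" .
  \<comment> \<open>The kernel has constant modulus, so this bound holds at every \<open>x\<close>,
    whereas square integrability of \<open>G x\<close> is obtained only for almost every
    \<open>x\<close>.\<close>
  have G1: "(\<integral>\<^sup>+y. ennreal (norm (G x y)) \<partial>lborel) < \<infinity>" for x
  proof -
    have "(\<integral>\<^sup>+y. ennreal (norm (G x y)) \<partial>lborel)
        \<le> (\<integral>\<^sup>+y. \<integral>\<^sup>+s. ennreal (norm (olct_kernel \<kappa> A1 s x * h (s, y))) \<partial>lborel \<partial>lborel)"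
      unfolding G_def by (intro nn_integral_mono norm_integral_le_nn_integral)
    also have "\<dots> = ennreal (sqrt (1 / (2 * pi * \<bar>pb A1\<bar>)))
        * (\<integral>\<^sup>+y. \<integral>\<^sup>+s. ennreal (norm (h (s, y))) \<partial>lborel \<partial>lborel)"
      by (simp add: norm_mult norm_olct_kernel'[OF \<kappa>] ennreal_mult nn_integral_cmult del: real_sqrt_divide)
    also have "\<dots> < \<infinity>"
      using h' by (simp add: ennreal_mult_less_top)
    finally show ?thesis .
  qed
  have "(\<integral>\<^sup>+p. ennreal ((norm (G (fst p) (snd p)))\<^sup>2) \<partial>(lborel \<Otimes>\<^sub>M lborel)) < \<infinity>"
    using G2 h(2) lborel.nn_integral_fst[of "\<lambda>p. ennreal ((norm (G (fst p) (snd p)))\<^sup>2)" lborel] by simp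
  then have "AE x in lborel. (\<integral>\<^sup>+y. ennreal ((norm (G (fst (x, y)) (snd (x, y))))\<^sup>2) \<partial>lborel) < \<infinity>"
    by (rule AE_nn_integral_fst_finite[rotated]) measurable
  then have "AE x in lborel. (\<integral>\<^sup>+y. ennreal ((norm (G x y))\<^sup>2) \<partial>lborel) < \<infinity>"
    by simp
  then have R: "AE x in lborel. (\<integral>\<^sup>+y. ennreal ((norm (LINT s|lborel. G x s * olct_kernel \<mu> A2 s y))\<^sup>2) \<partial>lborel)
      = (\<integral>\<^sup>+y. ennreal ((norm (G x y))\<^sup>2) \<partial>lborel)"
    by eventually_elim (auto intro!: G1 olct_plancherel_right[OF \<mu> b(2)])
  have ih: "integrable (lborel \<Otimes>\<^sub>M lborel) h"
    using h(1) by (simp add: integrable_iff_bounded)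
  have split: "(LINT s|(lborel \<Otimes>\<^sub>M lborel). olct_kernel \<kappa> A1 (fst s) x * h s * olct_kernel \<mu> A2 (snd s) y)
      = (LINT s|lborel. G x s * olct_kernel \<mu> A2 s y)" for x y
  proof -
    have i: "integrable (lborel \<Otimes>\<^sub>M lborel)
        (\<lambda>(s1, s2). olct_kernel \<kappa> A1 s1 x * h (s1, s2) * olct_kernel \<mu> A2 s2 y)"
      by (rule Bochner_Integration.integrable_bound[OF integrable_mult_right[OF integrable_norm[OF ih],
            of "sqrt (1 / (2 * pi * \<bar>pb A1\<bar>)) * sqrt (1 / (2 * pi * \<bar>pb A2\<bar>))"]])
         (auto simp: norm_mult norm_olct_kernel'[OF \<kappa>] norm_olct_kernel'[OF \<mu>] abs_mult mult_ac simp del: real_sqrt_divide)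
    have "(LINT s|(lborel \<Otimes>\<^sub>M lborel). olct_kernel \<kappa> A1 (fst s) x * h s * olct_kernel \<mu> A2 (snd s) y)
       = (LINT s2|lborel. LINT s1|lborel. olct_kernel \<kappa> A1 s1 x * h (s1, s2) * olct_kernel \<mu> A2 s2 y)"
      by (subst lborel_pair.integral_snd[OF i]) (simp add: case_prod_beta')
    also have "\<dots> = (LINT s|lborel. G x s * olct_kernel \<mu> A2 s y)"
    proof (rule integral_cong_AE)
      \<comment> \<open>The right kernel is pulled out of the integral over \<open>s1\<close> on
        integrable sections, that is, for almost every \<open>s2\<close>.\<close>
      have "AE s2 in lborel. integrable lborel (\<lambda>s1. h (s1, s2))"
        using lborel_pair.AE_integrable_snd[of "\<lambda>s1 s2. h (s1, s2)"] ih by simp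
      then show "AE s2 in lborel. (LINT s1|lborel. olct_kernel \<kappa> A1 s1 x * h (s1, s2) * olct_kernel \<mu> A2 s2 y)
          = G x s2 * olct_kernel \<mu> A2 s2 y"
      proof eventually_elim
        case (elim s2)
        have "integrable lborel (\<lambda>s1. olct_kernel \<kappa> A1 s1 x * h (s1, s2))"
          by (rule Bochner_Integration.integrable_bound[OF integrable_mult_right[OF integrable_norm[OF elim],
            of "sqrt (1 / (2 * pi * \<bar>pb A1\<bar>))"]])
             (auto simp: norm_mult norm_olct_kernel'[OF \<kappa>] simp del: real_sqrt_divide)
        then show ?case by (simp add: G_def)
      qed
    qed measurable
    finally show ?thesis .
  qed
  have "(\<integral>\<^sup>+u. ennreal ((norm (LINT s|(lborel \<Otimes>\<^sub>M lborel).
      olct_kernel \<kappa> A1 (fst s) (fst u) * h s * olct_kernel \<mu> A2 (snd s) (snd u)))\<^sup>2) \<partial>(lborel \<Otimes>\<^sub>M lborel))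
    = (\<integral>\<^sup>+x. \<integral>\<^sup>+y. ennreal ((norm (LINT s|lborel. G x s * olct_kernel \<mu> A2 s y))\<^sup>2) \<partial>lborel \<partial>lborel)"
    by (subst lborel.nn_integral_fst[symmetric], measurable) (simp add: split)
  also have "\<dots> = (\<integral>\<^sup>+x. \<integral>\<^sup>+y. ennreal ((norm (G x y))\<^sup>2) \<partial>lborel \<partial>lborel)"
    using R by (rule nn_integral_cong_AE)
  finally show ?thesis by (simp only: G2)
qed

section \<open>Affine substitutions and the degenerate cases with a vanishing b\<close>

lemma nn_integral_real_scale_shift:
  fixes d :: real
  assumes "f \<in> borel_measurable borel" and d: "d \<noteq> 0"
  shows "ennreal \<bar>d\<bar> * (\<integral>\<^sup>+x. f (d * (x - \<tau>)) \<partial>lborel) = (\<integral>\<^sup>+x. f x \<partial>lborel)"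
  using nn_integral_real_affine[OF assms, of "- d * \<tau>"] by (simp add: algebra_simps)

text \<open>\<open>P\<close> may be non-measurable, so the substitution is carried out on a Borel
  null set outside which \<open>P\<close> holds.\<close>

lemma AE_lborel_affine:
  fixes t :: "'a::euclidean_space"
  assumes "AE x in lborel. P x" and c: "c \<noteq> 0"
  shows "AE x in lborel. P (t + c *\<^sub>R x)"
proof -
  obtain N where N: "\<And>x. x \<in> space lborel - N \<Longrightarrow> P x" "N \<in> null_sets lborel"
    using assms(1) by (rule AE_E3) (rule that)
  then have [measurable]: "N \<in> sets borel" by auto
  have "AE x in lborel. x \<notin> N" by (rule AE_not_in[OF N(2)])
  then have "AE x in density (distr lborel borel (\<lambda>x. t + c *\<^sub>R x)) (\<lambda>_. \<bar>c\<bar>^DIM('a)). x \<notin> N"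
    unfolding lborel_affine[OF c, of t, symmetric] .
  then have "AE x in lborel. t + c *\<^sub>R x \<notin> N"
    using c by (subst (asm) AE_density, simp, subst (asm) AE_distr_iff) auto
  then show ?thesis by eventually_elim (use N(1) in auto)
qed

lemma AE_real_scale_shift:
  fixes d :: real
  assumes "AE x in lborel. P x" and d: "d \<noteq> 0"
  shows "AE x in lborel. P (d * (x - \<tau>))"
  using AE_lborel_affine[OF assms, of "- d * \<tau>"] by (simp add: algebra_simps)

text \<open>In the first variable the transform is a substitution, and the squared modulus |d| of
  the \<open>qsqrt\<close> factor compensates its Jacobian. In the second variable one-dimensional
  Plancherel acts on the sections.\<close>

lemma qolct_plancherel_first_degenerate:
  assumes \<kappa>: "\<kappa>\<^sup>2 = -1" and \<mu>: "\<mu>\<^sup>2 = -1" and d: "pd A1 \<noteq> 0" and b: "pb A2 \<noteq> 0"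
    and [measurable]: "h \<in> borel_measurable (borel \<Otimes>\<^sub>M borel)"
    and h: "(\<integral>\<^sup>+s. ennreal (norm (h s)) \<partial>(lborel \<Otimes>\<^sub>M lborel)) < \<infinity>"
      "(\<integral>\<^sup>+s. ennreal ((norm (h s))\<^sup>2) \<partial>(lborel \<Otimes>\<^sub>M lborel)) < \<infinity>"
  shows "(\<integral>\<^sup>+u. ennreal ((norm (LINT s2|lborel. qsqrt \<kappa> (pd A1) * olct_chirp \<kappa> A1 (fst u) *
          h (pd A1 * (fst u - p\<tau> A1), s2) * olct_kernel \<mu> A2 s2 (snd u)))\<^sup>2) \<partial>(lborel \<Otimes>\<^sub>M lborel))
    = (\<integral>\<^sup>+s. ennreal ((norm (h s))\<^sup>2) \<partial>(lborel \<Otimes>\<^sub>M lborel))"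
proof -
  define X where "X x = pd A1 * (x - p\<tau> A1)" for x
  have [measurable]: "X \<in> borel_measurable borel" unfolding X_def by measurable
  have AE_h: "AE x in lborel. (\<integral>\<^sup>+y. ennreal (norm (h (x, y))) \<partial>lborel) < \<infinity>"
      "AE x in lborel. (\<integral>\<^sup>+y. ennreal ((norm (h (x, y)))\<^sup>2) \<partial>lborel) < \<infinity>"
    using h by (auto intro!: AE_nn_integral_fst_finite simp del: infinity_ennreal_def)
  \<comment> \<open>Only almost every section of \<open>h\<close> has finite norms; the affine map
    \<open>X\<close> pulls the exceptional null set back to a null set.\<close>
  have "AE x in lborel. (\<integral>\<^sup>+y. ennreal (norm (h (X x, y))) \<partial>lborel) < \<infinity>"
      "AE x in lborel. (\<integral>\<^sup>+y. ennreal ((norm (h (X x, y)))\<^sup>2) \<partial>lborel) < \<infinity>"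
    unfolding X_def
    by (rule AE_real_scale_shift[OF AE_h(1) d] AE_real_scale_shift[OF AE_h(2) d])+
  then have "AE x in lborel. (\<integral>\<^sup>+y. ennreal ((norm (LINT s2|lborel. qsqrt \<kappa> (pd A1) * olct_chirp \<kappa> A1 x *
          h (X x, s2) * olct_kernel \<mu> A2 s2 y))\<^sup>2) \<partial>lborel)
      = ennreal \<bar>pd A1\<bar> * (\<integral>\<^sup>+y. ennreal ((norm (h (X x, y)))\<^sup>2) \<partial>lborel)"
  proof eventually_elim
    case (elim x)
    have i: "integrable lborel (\<lambda>s. h (X x, s))"
      using elim(1) by (simp add: integrable_iff_bounded)
    have i2: "integrable lborel (\<lambda>s. h (X x, s) * olct_kernel \<mu> A2 s y)" for y
      by (rule Bochner_Integration.integrable_bound[OF integrable_mult_right[OF integrable_norm[OF i],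
            of "sqrt (1 / (2 * pi * \<bar>pb A2\<bar>))"]])
         (auto simp: norm_mult norm_olct_kernel'[OF \<mu>] mult.commute simp del: real_sqrt_divide)
    have "(norm (LINT s2|lborel. qsqrt \<kappa> (pd A1) * olct_chirp \<kappa> A1 x * h (X x, s2) * olct_kernel \<mu> A2 s2 y))\<^sup>2
        = \<bar>pd A1\<bar> * (norm (LINT s2|lborel. h (X x, s2) * olct_kernel \<mu> A2 s2 y))\<^sup>2" for y
      using i2[of y]
      by (simp add: mult.assoc norm_mult norm_olct_chirp[OF \<kappa>] power_mult_distrib norm_qsqrt_power2[OF \<kappa>])
    then show ?case
      by (simp add: ennreal_mult nn_integral_cmult olct_plancherel_right[OF \<mu> b _ elim])
  qed
  then have "(\<integral>\<^sup>+x. \<integral>\<^sup>+y. ennreal ((norm (LINT s2|lborel. qsqrt \<kappa> (pd A1) * olct_chirp \<kappa> A1 x *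
          h (X x, s2) * olct_kernel \<mu> A2 s2 y))\<^sup>2) \<partial>lborel \<partial>lborel)
      = (\<integral>\<^sup>+x. ennreal \<bar>pd A1\<bar> * (\<integral>\<^sup>+y. ennreal ((norm (h (X x, y)))\<^sup>2) \<partial>lborel) \<partial>lborel)"
    by (rule nn_integral_cong_AE)
  also have "\<dots> = ennreal \<bar>pd A1\<bar> * (\<integral>\<^sup>+x. \<integral>\<^sup>+y. ennreal ((norm (h (X x, y)))\<^sup>2) \<partial>lborel \<partial>lborel)"
    by (rule nn_integral_cmult) measurable
  also have "\<dots> = (\<integral>\<^sup>+x. \<integral>\<^sup>+y. ennreal ((norm (h (x, y)))\<^sup>2) \<partial>lborel \<partial>lborel)"
    unfolding X_def by (rule nn_integral_real_scale_shift[OF _ d]) measurable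
  also have "\<dots> = (\<integral>\<^sup>+s. ennreal ((norm (h s))\<^sup>2) \<partial>(lborel \<Otimes>\<^sub>M lborel))"
    by (rule lborel.nn_integral_fst) measurable
  finally show ?thesis
    by (subst lborel.nn_integral_fst[symmetric], measurable) (simp add: X_def)
qed

lemma qolct_plancherel_second_degenerate:
  assumes \<kappa>: "\<kappa>\<^sup>2 = -1" and \<mu>: "\<mu>\<^sup>2 = -1" and b: "pb A1 \<noteq> 0" and d: "pd A2 \<noteq> 0"
    and [measurable]: "h \<in> borel_measurable (borel \<Otimes>\<^sub>M borel)"
    and h: "(\<integral>\<^sup>+s. ennreal (norm (h s)) \<partial>(lborel \<Otimes>\<^sub>M lborel)) < \<infinity>"
      "(\<integral>\<^sup>+s. ennreal ((norm (h s))\<^sup>2) \<partial>(lborel \<Otimes>\<^sub>M lborel)) < \<infinity>"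
  shows "(\<integral>\<^sup>+u. ennreal ((norm (LINT s1|lborel. qsqrt \<mu> (pd A2) * olct_kernel \<kappa> A1 s1 (fst u) *
          h (s1, pd A2 * (snd u - p\<tau> A2)) * olct_chirp \<mu> A2 (snd u)))\<^sup>2) \<partial>(lborel \<Otimes>\<^sub>M lborel))
    = (\<integral>\<^sup>+s. ennreal ((norm (h s))\<^sup>2) \<partial>(lborel \<Otimes>\<^sub>M lborel))"
proof -
  define Y where "Y y = pd A2 * (y - p\<tau> A2)" for y
  have [measurable]: "Y \<in> borel_measurable borel" unfolding Y_def by measurable
  have AE_h: "AE y in lborel. (\<integral>\<^sup>+x. ennreal (norm (h (x, y))) \<partial>lborel) < \<infinity>"
      "AE y in lborel. (\<integral>\<^sup>+x. ennreal ((norm (h (x, y)))\<^sup>2) \<partial>lborel) < \<infinity>"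
    using h by (auto intro!: AE_nn_integral_snd_finite simp del: infinity_ennreal_def)
  have "AE y in lborel. (\<integral>\<^sup>+x. ennreal (norm (h (x, Y y))) \<partial>lborel) < \<infinity>"
      "AE y in lborel. (\<integral>\<^sup>+x. ennreal ((norm (h (x, Y y)))\<^sup>2) \<partial>lborel) < \<infinity>"
    unfolding Y_def
    by (rule AE_real_scale_shift[OF AE_h(1) d] AE_real_scale_shift[OF AE_h(2) d])+
  then have "AE y in lborel. (\<integral>\<^sup>+x. ennreal ((norm (LINT s1|lborel. qsqrt \<mu> (pd A2) * olct_kernel \<kappa> A1 s1 x *
          h (s1, Y y) * olct_chirp \<mu> A2 y))\<^sup>2) \<partial>lborel)
      = ennreal \<bar>pd A2\<bar> * (\<integral>\<^sup>+x. ennreal ((norm (h (x, Y y)))\<^sup>2) \<partial>lborel)"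
  proof eventually_elim
    case (elim y)
    have i: "integrable lborel (\<lambda>s. h (s, Y y))"
      using elim(1) by (simp add: integrable_iff_bounded)
    have i2: "integrable lborel (\<lambda>s. olct_kernel \<kappa> A1 s x * h (s, Y y))" for x
      by (rule Bochner_Integration.integrable_bound[OF integrable_mult_right[OF integrable_norm[OF i],
            of "sqrt (1 / (2 * pi * \<bar>pb A1\<bar>))"]])
         (auto simp: norm_mult norm_olct_kernel'[OF \<kappa>] simp del: real_sqrt_divide)
    have "(norm (LINT s1|lborel. qsqrt \<mu> (pd A2) * olct_kernel \<kappa> A1 s1 x * h (s1, Y y) * olct_chirp \<mu> A2 y))\<^sup>2
        = \<bar>pd A2\<bar> * (norm (LINT s1|lborel. olct_kernel \<kappa> A1 s1 x * h (s1, Y y)))\<^sup>2" for x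
    proof -
      \<comment> \<open>The outer factors do not depend on \<open>s1\<close>; each leaves the
        integral on its own side, and in the norm only its modulus remains.\<close>
      have "(LINT s1|lborel. qsqrt \<mu> (pd A2) * olct_kernel \<kappa> A1 s1 x * h (s1, Y y) * olct_chirp \<mu> A2 y)
        = (LINT s1|lborel. qsqrt \<mu> (pd A2) * (olct_kernel \<kappa> A1 s1 x * h (s1, Y y)) * olct_chirp \<mu> A2 y)"
        by (simp only: mult.assoc)
      also have "\<dots> = qsqrt \<mu> (pd A2) * (LINT s1|lborel. olct_kernel \<kappa> A1 s1 x * h (s1, Y y)) * olct_chirp \<mu> A2 y"
        using i2[of x] by simp
      finally show ?thesis
        by (simp add: norm_mult norm_olct_chirp[OF \<mu>] power_mult_distrib norm_qsqrt_power2[OF \<mu>])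
    qed
    then show ?case
      by (simp add: ennreal_mult nn_integral_cmult olct_plancherel_left[OF \<kappa> b _ elim])
  qed
  then have "(\<integral>\<^sup>+y. \<integral>\<^sup>+x. ennreal ((norm (LINT s1|lborel. qsqrt \<mu> (pd A2) * olct_kernel \<kappa> A1 s1 x *
          h (s1, Y y) * olct_chirp \<mu> A2 y))\<^sup>2) \<partial>lborel \<partial>lborel)
      = (\<integral>\<^sup>+y. ennreal \<bar>pd A2\<bar> * (\<integral>\<^sup>+x. ennreal ((norm (h (x, Y y)))\<^sup>2) \<partial>lborel) \<partial>lborel)"
    by (rule nn_integral_cong_AE)
  also have "\<dots> = ennreal \<bar>pd A2\<bar> * (\<integral>\<^sup>+y. \<integral>\<^sup>+x. ennreal ((norm (h (x, Y y)))\<^sup>2) \<partial>lborel \<partial>lborel)"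
    by (rule nn_integral_cmult) measurable
  also have "\<dots> = (\<integral>\<^sup>+y. \<integral>\<^sup>+x. ennreal ((norm (h (x, y)))\<^sup>2) \<partial>lborel \<partial>lborel)"
    unfolding Y_def by (rule nn_integral_real_scale_shift[OF _ d]) measurable
  also have "\<dots> = (\<integral>\<^sup>+s. ennreal ((norm (h s))\<^sup>2) \<partial>(lborel \<Otimes>\<^sub>M lborel))"
    by (rule lborel_pair.nn_integral_snd) measurable
  finally show ?thesis
    by (subst lborel_pair.nn_integral_snd[symmetric], measurable) (simp add: Y_def)
qed

text \<open>No integral is left: the transform is a substitution in both variables, with the squared
  modulus of the root compensating both Jacobians.\<close>

lemma qolct_plancherel_degenerate:
  assumes \<kappa>: "\<kappa>\<^sup>2 = -1" and \<mu>: "\<mu>\<^sup>2 = -1" and d: "pd A1 \<noteq> 0" "pd A2 \<noteq> 0"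
    and [measurable]: "h \<in> borel_measurable (borel \<Otimes>\<^sub>M borel)"
  shows "(\<integral>\<^sup>+u. ennreal ((norm (qsqrt \<kappa> (pd A1 * pd A2) * olct_chirp \<kappa> A1 (fst u) *
          h (pd A1 * (fst u - p\<tau> A1), pd A2 * (snd u - p\<tau> A2)) * olct_chirp \<mu> A2 (snd u)))\<^sup>2) \<partial>(lborel \<Otimes>\<^sub>M lborel))
    = (\<integral>\<^sup>+s. ennreal ((norm (h s))\<^sup>2) \<partial>(lborel \<Otimes>\<^sub>M lborel))"
proof -
  have eq: "(norm (qsqrt \<kappa> (pd A1 * pd A2) * olct_chirp \<kappa> A1 x * q * olct_chirp \<mu> A2 y))\<^sup>2
      = \<bar>pd A1\<bar> * (\<bar>pd A2\<bar> * (norm q)\<^sup>2)" for x y q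
    by (simp add: norm_mult norm_olct_chirp[OF \<kappa>] norm_olct_chirp[OF \<mu>] power_mult_distrib
        norm_qsqrt_power2[OF \<kappa>] abs_mult)
  have "(\<integral>\<^sup>+u. ennreal ((norm (qsqrt \<kappa> (pd A1 * pd A2) * olct_chirp \<kappa> A1 (fst u) *
          h (pd A1 * (fst u - p\<tau> A1), pd A2 * (snd u - p\<tau> A2)) * olct_chirp \<mu> A2 (snd u)))\<^sup>2) \<partial>(lborel \<Otimes>\<^sub>M lborel))
    = (\<integral>\<^sup>+x. \<integral>\<^sup>+y. ennreal \<bar>pd A1\<bar> * (ennreal \<bar>pd A2\<bar> *
        ennreal ((norm (h (pd A1 * (x - p\<tau> A1), pd A2 * (y - p\<tau> A2))))\<^sup>2)) \<partial>lborel \<partial>lborel)"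
    unfolding eq by (subst lborel.nn_integral_fst[symmetric], measurable) (simp add: ennreal_mult)
  also have "\<dots> = (\<integral>\<^sup>+x. ennreal \<bar>pd A1\<bar> * (ennreal \<bar>pd A2\<bar> *
        (\<integral>\<^sup>+y. ennreal ((norm (h (pd A1 * (x - p\<tau> A1), pd A2 * (y - p\<tau> A2))))\<^sup>2) \<partial>lborel)) \<partial>lborel)"
    by (simp add: nn_integral_cmult)
  also have "\<dots> = (\<integral>\<^sup>+x. ennreal \<bar>pd A1\<bar> * (\<integral>\<^sup>+y. ennreal ((norm (h (pd A1 * (x - p\<tau> A1), y)))\<^sup>2) \<partial>lborel) \<partial>lborel)"
    using nn_integral_real_scale_shift[OF _ d(2), of "\<lambda>y. ennreal ((norm (h (pd A1 * (_ - p\<tau> A1), y)))\<^sup>2)"]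
    by simp
  also have "\<dots> = ennreal \<bar>pd A1\<bar> * (\<integral>\<^sup>+x. \<integral>\<^sup>+y. ennreal ((norm (h (pd A1 * (x - p\<tau> A1), y)))\<^sup>2) \<partial>lborel \<partial>lborel)"
    by (rule nn_integral_cmult) measurable
  also have "\<dots> = (\<integral>\<^sup>+x. \<integral>\<^sup>+y. ennreal ((norm (h (x, y)))\<^sup>2) \<partial>lborel \<partial>lborel)"
    by (rule nn_integral_real_scale_shift[OF _ d(1)]) measurable
  also have "\<dots> = (\<integral>\<^sup>+s. ennreal ((norm (h s))\<^sup>2) \<partial>(lborel \<Otimes>\<^sub>M lborel))"
    by (rule lborel.nn_integral_fst) measurable
  finally show ?thesis .
qed

theorem qolct_plancherel:
  assumes \<kappa>: "\<kappa>\<^sup>2 = -1" and \<mu>: "\<mu>\<^sup>2 = -1"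
    and A1: "pa A1 * pd A1 - pb A1 * pc A1 = 1" and A2: "pa A2 * pd A2 - pb A2 * pc A2 = 1"
    and m: "h \<in> borel_measurable (borel \<Otimes>\<^sub>M borel)"
    and h: "(\<integral>\<^sup>+s. ennreal (norm (h s)) \<partial>(lborel \<Otimes>\<^sub>M lborel)) < \<infinity>"
      "(\<integral>\<^sup>+s. ennreal ((norm (h s))\<^sup>2) \<partial>(lborel \<Otimes>\<^sub>M lborel)) < \<infinity>"
  shows "(\<integral>\<^sup>+u. ennreal ((norm (qolct \<kappa> \<mu> A1 A2 h u))\<^sup>2) \<partial>(lborel \<Otimes>\<^sub>M lborel))
    = (\<integral>\<^sup>+s. ennreal ((norm (h s))\<^sup>2) \<partial>(lborel \<Otimes>\<^sub>M lborel))"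
proof -
  \<comment> \<open>If b = 0, the determinant condition reads a d = 1; this is what makes the
    substitutions by d invertible.\<close>
  have d: "pb A1 = 0 \<Longrightarrow> pd A1 \<noteq> 0" "pb A2 = 0 \<Longrightarrow> pd A2 \<noteq> 0"
    using A1 A2 by auto
  consider "pb A1 \<noteq> 0" "pb A2 \<noteq> 0" | "pb A1 = 0" "pb A2 \<noteq> 0" | "pb A1 \<noteq> 0" "pb A2 = 0"
    | "pb A1 = 0" "pb A2 = 0" by blast
  then show ?thesis
  proof cases
    case 1
    then show ?thesis
      using qolct_plancherel_both[OF \<kappa> \<mu> 1 m h] by (simp add: qolct_borel[OF m])
  next
    case 2
    then show ?thesis
      using qolct_plancherel_first_degenerate[OF \<kappa> \<mu> d(1) _ m h] by (simp add: qolct_borel[OF m])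
  next
    case 3
    then show ?thesis
      using qolct_plancherel_second_degenerate[OF \<kappa> \<mu> _ d(2) m h] by (simp add: qolct_borel[OF m])
  next
    case 4
    then show ?thesis
      using qolct_plancherel_degenerate[OF \<kappa> \<mu> d m] by (simp add: qolct_borel[OF m])
  qed
qed

section \<open>The Wigner-Ville distribution\<close>

lemma nn_integral_lborel_affine:
  fixes t :: "'a::euclidean_space"
  assumes [measurable]: "f \<in> borel_measurable borel" and c: "c \<noteq> 0"
  shows "(\<integral>\<^sup>+x. f x \<partial>lborel) = ennreal (\<bar>c\<bar>^DIM('a)) * (\<integral>\<^sup>+x. f (t + c *\<^sub>R x) \<partial>lborel)"
  by (subst lborel_affine[OF c, of t])
     (simp add: nn_integral_density nn_integral_distr nn_integral_cmult)

text \<open>Lebesgue measure is complete, so \<open>F\<close> inherits measurability from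
  \<open>G\<close>.\<close>

lemma integral_lebesgue_cong_AE:
  fixes F G :: "'a::euclidean_space \<Rightarrow> 'b::euclidean_space"
  assumes G: "G \<in> borel_measurable borel" and eq: "AE x in lborel. F x = G x"
  shows "(LINT x|lebesgue. F x) = (LINT x|lebesgue. G x)"
proof (rule integral_cong_AE)
  show eq': "AE x in lebesgue. F x = G x"
    using eq by (rule AE_completion)
  show G': "G \<in> borel_measurable lebesgue"
    using G by (simp add: measurable_completion)
  show "F \<in> borel_measurable lebesgue"
    by (rule borel_measurable_AE[OF G']) (use eq' in eventually_elim, simp)
qed

text \<open>A cylinder over a null set is a null set.\<close>

lemma
  fixes P :: "'a::euclidean_space \<Rightarrow> bool" and Q :: "'b::euclidean_space \<Rightarrow> bool"
  shows AE_lborel_fst: "AE x in lborel. P x \<Longrightarrow> AE p in lborel \<Otimes>\<^sub>M (lborel :: 'b measure). P (fst p)"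
    and AE_lborel_snd: "AE y in lborel. Q y \<Longrightarrow> AE p in (lborel :: 'a measure) \<Otimes>\<^sub>M lborel. Q (snd p)"
proof -
  assume "AE x in lborel. P x"
  then obtain N where N: "\<And>x. x \<in> space lborel - N \<Longrightarrow> P x" "N \<in> null_sets lborel"
    by (rule AE_E3) (rule that)
  then have [measurable]: "N \<in> sets borel" by auto
  have "AE p in lborel \<Otimes>\<^sub>M (lborel :: 'b measure). fst p \<notin> N"
  proof (rule lborel_pair.AE_pair_measure)
    show "AE x in lborel. AE y in (lborel :: 'b measure). fst (x, y) \<notin> N"
      using AE_not_in[OF N(2)] by eventually_elim simp
  qed measurable
  then show "AE p in lborel \<Otimes>\<^sub>M (lborel :: 'b measure). P (fst p)"
    by eventually_elim (use N(1) in auto)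
next
  assume "AE y in lborel. Q y"
  then obtain N where N: "\<And>x. x \<in> space lborel - N \<Longrightarrow> Q x" "N \<in> null_sets lborel"
    by (rule AE_E3) (rule that)
  then have [measurable]: "N \<in> sets borel" by auto
  have "AE p in (lborel :: 'a measure) \<Otimes>\<^sub>M lborel. snd p \<notin> N"
  proof (rule lborel_pair.AE_pair_measure)
    show "AE x in (lborel :: 'a measure). AE y in lborel. snd (x, y) \<notin> N"
      using AE_not_in[OF N(2)] by simp
  qed measurable
  then show "AE p in (lborel :: 'a measure) \<Otimes>\<^sub>M lborel. Q (snd p)"
    by eventually_elim (use N(1) in auto)
qed

text \<open>A null set of the plane is sliced, so that the one-dimensional substitution can be
  applied one coordinate at a time.\<close>

lemma AE_pair_scale_shift:
  fixes c d :: real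
  assumes "AE s in lborel \<Otimes>\<^sub>M lborel. P s" and c: "c \<noteq> 0" and d: "d \<noteq> 0"
  shows "AE u in lborel \<Otimes>\<^sub>M lborel. P (c * (fst u - \<sigma>), d * (snd u - \<tau>))"
proof -
  obtain N where N: "\<And>x. x \<in> space (lborel \<Otimes>\<^sub>M lborel) - N \<Longrightarrow> P x" "N \<in> null_sets (lborel \<Otimes>\<^sub>M lborel)"
    using assms(1) by (rule AE_E3) (rule that)
  have "N \<in> sets (lborel \<Otimes>\<^sub>M lborel)" using N(2) by auto
  then have [measurable]: "N \<in> sets (borel \<Otimes>\<^sub>M borel)" by (simp cong: sets_pair_measure_cong)
  have "AE x in lborel. AE y in lborel. (x, y) \<notin> N"
    using AE_not_in[OF N(2)] by (rule lborel_pair.AE_pair)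
  then have "AE x in lborel. AE y in lborel. (c * (x - \<sigma>), y) \<notin> N"
    using c by (rule AE_real_scale_shift)
  then have "AE x in lborel. AE y in lborel. (c * (x - \<sigma>), d * (y - \<tau>)) \<notin> N"
    by eventually_elim (rule AE_real_scale_shift[OF _ d])
  then have "AE u in lborel \<Otimes>\<^sub>M lborel. (c * (fst u - \<sigma>), d * (snd u - \<tau>)) \<notin> N"
  proof (intro lborel_pair.AE_pair_measure)
    show "{u \<in> space (lborel \<Otimes>\<^sub>M lborel). (c * (fst u - \<sigma>), d * (snd u - \<tau>)) \<notin> N}
        \<in> sets (lborel \<Otimes>\<^sub>M lborel)"
      by measurable
  qed simp
  then show ?thesis
    by eventually_elim (use N(1) in \<open>auto simp: space_pair_measure\<close>)
qed

lemma AE_pair_snd_fst: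
  fixes P :: "'a::euclidean_space \<times> 'b::euclidean_space \<Rightarrow> bool"
  assumes "AE s in lborel \<Otimes>\<^sub>M lborel. P s"
  shows "AE y in lborel. AE x in lborel. P (x, y)"
proof -
  obtain N where N: "\<And>x. x \<in> space (lborel \<Otimes>\<^sub>M lborel) - N \<Longrightarrow> P x" "N \<in> null_sets (lborel \<Otimes>\<^sub>M lborel)"
    using assms(1) by (rule AE_E3) (rule that)
  have "N \<in> sets (lborel \<Otimes>\<^sub>M lborel)" using N(2) by auto
  then have [measurable]: "N \<in> sets (borel \<Otimes>\<^sub>M borel)" by (simp cong: sets_pair_measure_cong)
  have "AE x in lborel. AE y in lborel. (x, y) \<notin> N"
    using AE_not_in[OF N(2)] by (rule lborel_pair.AE_pair)
  then have "AE y in lborel. AE x in lborel. (x, y) \<notin> N"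
    by (subst (asm) lborel_pair.AE_commute) measurable
  then show ?thesis
  proof eventually_elim
    case (elim y)
    then show ?case by eventually_elim (use N(1) in \<open>auto simp: space_pair_measure\<close>)
  qed
qed

text \<open>With both b nonzero the defining integrals agree at every \<open>u\<close>. If some b is
  0, the function is restricted to a line or a point that depends on \<open>u\<close>; since affine
  maps pull null sets back to null sets, agreement is kept for almost every
  \<open>u\<close>.\<close>

lemma qolct_cong_AE:
  assumes A1: "pa A1 * pd A1 - pb A1 * pc A1 = 1" and A2: "pa A2 * pd A2 - pb A2 * pc A2 = 1"
    and [measurable]: "h' \<in> borel_measurable (borel \<Otimes>\<^sub>M borel)"
    and eq: "AE s in lborel \<Otimes>\<^sub>M lborel. h s = h' s"
  shows "AE u in lborel \<Otimes>\<^sub>M lborel. qolct \<kappa> \<mu> A1 A2 h u = qolct \<kappa> \<mu> A1 A2 h' u"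
proof -
  have d: "pb A1 = 0 \<Longrightarrow> pd A1 \<noteq> 0" "pb A2 = 0 \<Longrightarrow> pd A2 \<noteq> 0"
    using A1 A2 by auto
  consider "pb A1 \<noteq> 0" "pb A2 \<noteq> 0" | "pb A1 = 0" "pb A2 \<noteq> 0" | "pb A1 \<noteq> 0" "pb A2 = 0"
    | "pb A1 = 0" "pb A2 = 0" by blast
  then show ?thesis
  proof cases
    case 1
    have "(LINT s|lebesgue. olct_kernel \<kappa> A1 (fst s) (fst u) * h s * olct_kernel \<mu> A2 (snd s) (snd u))
      = (LINT s|lebesgue. olct_kernel \<kappa> A1 (fst s) (fst u) * h' s * olct_kernel \<mu> A2 (snd s) (snd u))" for u
    proof (rule integral_lebesgue_cong_AE)
      show "(\<lambda>s. olct_kernel \<kappa> A1 (fst s) (fst u) * h' s * olct_kernel \<mu> A2 (snd s) (snd u)) \<in> borel_measurable borel"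
        unfolding borel_prod[symmetric] by measurable
      show "AE s in lborel. olct_kernel \<kappa> A1 (fst s) (fst u) * h s * olct_kernel \<mu> A2 (snd s) (snd u)
        = olct_kernel \<kappa> A1 (fst s) (fst u) * h' s * olct_kernel \<mu> A2 (snd s) (snd u)"
        using eq unfolding lborel_prod by eventually_elim simp
    qed
    then show ?thesis using 1 by (simp add: qolct_def)
  next
    case 2
    have "AE x in lborel. AE y in lborel. h (x, y) = h' (x, y)"
      using eq by (rule lborel_pair.AE_pair)
    then have "AE x in lborel. AE y in lborel. h (pd A1 * (x - p\<tau> A1), y) = h' (pd A1 * (x - p\<tau> A1), y)"
      using d(1) 2 by (intro AE_real_scale_shift[where P="\<lambda>x. AE y in lborel. h (x, y) = h' (x, y)"])
    then have "AE u in lborel \<Otimes>\<^sub>M (lborel :: real measure). AE y in lborel. h (pd A1 * (fst u - p\<tau> A1), y) = h' (pd A1 * (fst u - p\<tau> A1), y)"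
      by (rule AE_lborel_fst)
    then show ?thesis
    proof eventually_elim
      case (elim u)
      have "(LINT s2|lebesgue. qsqrt \<kappa> (pd A1) * olct_chirp \<kappa> A1 (fst u) *
          h (pd A1 * (fst u - p\<tau> A1), s2) * olct_kernel \<mu> A2 s2 (snd u))
        = (LINT s2|lebesgue. qsqrt \<kappa> (pd A1) * olct_chirp \<kappa> A1 (fst u) *
          h' (pd A1 * (fst u - p\<tau> A1), s2) * olct_kernel \<mu> A2 s2 (snd u))"
        by (rule integral_lebesgue_cong_AE, measurable) (use elim in eventually_elim, simp)
      then show ?case using 2 by (simp add: qolct_def)
    qed
  next
    case 3
    have "AE y in lborel. AE x in lborel. h (x, y) = h' (x, y)"
      using eq by (rule AE_pair_snd_fst)
    then have "AE y in lborel. AE x in lborel. h (x, pd A2 * (y - p\<tau> A2)) = h' (x, pd A2 * (y - p\<tau> A2))"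
      using d(2) 3 by (intro AE_real_scale_shift[where P="\<lambda>y. AE x in lborel. h (x, y) = h' (x, y)"])
    then have "AE u in (lborel :: real measure) \<Otimes>\<^sub>M lborel. AE x in lborel. h (x, pd A2 * (snd u - p\<tau> A2)) = h' (x, pd A2 * (snd u - p\<tau> A2))"
      by (rule AE_lborel_snd)
    then show ?thesis
    proof eventually_elim
      case (elim u)
      have "(LINT s1|lebesgue. qsqrt \<mu> (pd A2) * olct_kernel \<kappa> A1 s1 (fst u) *
          h (s1, pd A2 * (snd u - p\<tau> A2)) * olct_chirp \<mu> A2 (snd u))
        = (LINT s1|lebesgue. qsqrt \<mu> (pd A2) * olct_kernel \<kappa> A1 s1 (fst u) *
          h' (s1, pd A2 * (snd u - p\<tau> A2)) * olct_chirp \<mu> A2 (snd u))"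
        by (rule integral_lebesgue_cong_AE, measurable) (use elim in eventually_elim, simp)
      then show ?case using 3 by (simp add: qolct_def)
    qed
  next
    case 4
    show ?thesis
      using AE_pair_scale_shift[OF eq d(1)[OF 4(1)] d(2)[OF 4(2)], of "p\<tau> A1" "p\<tau> A2"]
      by eventually_elim (simp add: qolct_def 4)
  qed
qed

section \<open>Borel representatives of quaternion-valued functions\<close>

lemma borel_measurable_quat_sel [measurable]:
  "qRe \<in> borel_measurable borel" "qI \<in> borel_measurable borel"
  "qJ \<in> borel_measurable borel" "qK \<in> borel_measurable borel"
proof -
  have eqs: "qRe = (\<lambda>q. inner q (Quat 1 0 0 0))" "qI = (\<lambda>q. inner q (Quat 0 1 0 0))"
    "qJ = (\<lambda>q. inner q (Quat 0 0 1 0))" "qK = (\<lambda>q. inner q (Quat 0 0 0 1))"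
    by (auto simp: inner_quat_def)
  show "qRe \<in> borel_measurable borel" "qI \<in> borel_measurable borel"
    "qJ \<in> borel_measurable borel" "qK \<in> borel_measurable borel"
    unfolding eqs by measurable
qed

lemma borel_measurable_Quat [measurable (raw)]:
  assumes [measurable]: "a \<in> borel_measurable M" "b \<in> borel_measurable M"
    "c \<in> borel_measurable M" "d \<in> borel_measurable M"
  shows "(\<lambda>x. Quat (a x) (b x) (c x) (d x)) \<in> borel_measurable M"
proof -
  have "(\<lambda>x. Quat (a x) (b x) (c x) (d x)) = (\<lambda>x. a x *\<^sub>R Quat 1 0 0 0 + b x *\<^sub>R Quat 0 1 0 0
      + c x *\<^sub>R Quat 0 0 1 0 + d x *\<^sub>R Quat 0 0 0 1)"
    by (simp add: fun_eq_iff quat_eq_iff)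
  then show ?thesis by simp
qed

text \<open>A Borel representative makes composites such as f (t + s / 2) jointly measurable in
  \<open>t\<close> and \<open>s\<close>. It is assembled from real-valued representatives of the
  four components.\<close>

lemma lebesgue_measurable_quat_AE_borel:
  fixes f :: "'a::euclidean_space \<Rightarrow> quat"
  assumes [measurable]: "f \<in> borel_measurable lebesgue"
  obtains f' where "f' \<in> borel_measurable borel" "AE x in lborel. f x = f' x"
proof -
  have "(\<lambda>x. qRe (f x)) \<in> borel_measurable lebesgue" "(\<lambda>x. qI (f x)) \<in> borel_measurable lebesgue"
    "(\<lambda>x. qJ (f x)) \<in> borel_measurable lebesgue" "(\<lambda>x. qK (f x)) \<in> borel_measurable lebesgue"
    by measurable
  note this[THEN completion_ex_borel_measurable_real]
  then obtain a b c d where m: "a \<in> borel_measurable lborel" "b \<in> borel_measurable lborel"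
      "c \<in> borel_measurable lborel" "d \<in> borel_measurable lborel"
    and ae: "AE x in lborel. qRe (f x) = a x" "AE x in lborel. qI (f x) = b x"
      "AE x in lborel. qJ (f x) = c x" "AE x in lborel. qK (f x) = d x"
    by blast
  show thesis
  proof (rule that)
    show "(\<lambda>x. Quat (a x) (b x) (c x) (d x)) \<in> borel_measurable borel"
      using m by (intro borel_measurable_Quat) simp_all
    show "AE x in lborel. f x = Quat (a x) (b x) (c x) (d x)"
      using ae by eventually_elim (simp add: quat_eq_iff)
  qed
qed

lemma esqrt_power2: "(esqrt x)\<^sup>2 = x"
  by (cases x) (auto simp: esqrt_def ennreal_power power2_eq_square[of top])

text \<open>The Jacobian of \<open>(t, s) \<mapsto> (t + s / 2, t - s / 2)\<close> is \<open>1\<close> in absolute value.\<close>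

lemma nn_integral_wigner_substitution:
  fixes \<Phi> \<Gamma> :: "'a::euclidean_space \<Rightarrow> ennreal"
  assumes [measurable]: "\<Phi> \<in> borel_measurable borel" "\<Gamma> \<in> borel_measurable borel"
  shows "(\<integral>\<^sup>+t. \<integral>\<^sup>+s. \<Phi> (t + s /\<^sub>R 2) * \<Gamma> (t - s /\<^sub>R 2) \<partial>lborel \<partial>lborel)
    = (\<integral>\<^sup>+x. \<Phi> x \<partial>lborel) * (\<integral>\<^sup>+x. \<Gamma> x \<partial>lborel)"
proof -
  let ?c = "ennreal (2 ^ DIM('a))"
  \<comment> \<open>Substituting s = 2 (y - t) produces the factor 2^n, where n is the dimension;
    the later substitution x = 2 t - y in the variable \<open>t\<close> uses it up.\<close>
  have "(\<integral>\<^sup>+s. \<Phi> (t + s /\<^sub>R 2) * \<Gamma> (t - s /\<^sub>R 2) \<partial>lborel)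
      = ?c * (\<integral>\<^sup>+y. \<Phi> y * \<Gamma> (2 *\<^sub>R t - y) \<partial>lborel)" for t
  proof -
    have "(\<integral>\<^sup>+s. \<Phi> (t + s /\<^sub>R 2) * \<Gamma> (t - s /\<^sub>R 2) \<partial>lborel)
      = ?c * (\<integral>\<^sup>+y. \<Phi> (t + (- 2 *\<^sub>R t + 2 *\<^sub>R y) /\<^sub>R 2) * \<Gamma> (t - (- 2 *\<^sub>R t + 2 *\<^sub>R y) /\<^sub>R 2) \<partial>lborel)"
      by (subst nn_integral_lborel_affine[where c=2 and t="- 2 *\<^sub>R t"]) simp_all
    also have "(\<lambda>y. \<Phi> (t + (- 2 *\<^sub>R t + 2 *\<^sub>R y) /\<^sub>R 2) * \<Gamma> (t - (- 2 *\<^sub>R t + 2 *\<^sub>R y) /\<^sub>R 2))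
      = (\<lambda>y. \<Phi> y * \<Gamma> (2 *\<^sub>R t - y))"
    proof -
      have "(- 2 *\<^sub>R t + 2 *\<^sub>R y) /\<^sub>R 2 = y - t" for y :: 'a
        by (simp only: scaleR_add_right scaleR_scaleR) simp
      moreover have "t + (y - t) = y" "t - (y - t) = 2 *\<^sub>R t - y" for y
        by (simp_all add: scaleR_2)
      ultimately show ?thesis by (simp only:)
    qed
    finally show ?thesis .
  qed
  then have "(\<integral>\<^sup>+t. \<integral>\<^sup>+s. \<Phi> (t + s /\<^sub>R 2) * \<Gamma> (t - s /\<^sub>R 2) \<partial>lborel \<partial>lborel)
      = ?c * (\<integral>\<^sup>+t. \<integral>\<^sup>+y. \<Phi> y * \<Gamma> (2 *\<^sub>R t - y) \<partial>lborel \<partial>lborel)"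
    by (simp add: nn_integral_cmult)
  also have "(\<integral>\<^sup>+t. \<integral>\<^sup>+y. \<Phi> y * \<Gamma> (2 *\<^sub>R t - y) \<partial>lborel \<partial>lborel)
      = (\<integral>\<^sup>+y. \<integral>\<^sup>+t. \<Phi> y * \<Gamma> (2 *\<^sub>R t - y) \<partial>lborel \<partial>lborel)"
    by (rule lborel_pair.Fubini') measurable
  also have "\<dots> = (\<integral>\<^sup>+y. \<Phi> y * (\<integral>\<^sup>+t. \<Gamma> (2 *\<^sub>R t - y) \<partial>lborel) \<partial>lborel)"
    by (simp add: nn_integral_cmult)
  also have "?c * \<dots> = (\<integral>\<^sup>+y. \<Phi> y * (?c * (\<integral>\<^sup>+t. \<Gamma> (2 *\<^sub>R t - y) \<partial>lborel)) \<partial>lborel)"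
    by (subst nn_integral_cmult[symmetric]) (simp_all add: ac_simps)
  also have "\<dots> = (\<integral>\<^sup>+y. \<Phi> y * (\<integral>\<^sup>+x. \<Gamma> x \<partial>lborel) \<partial>lborel)"
  proof (rule nn_integral_cong)
    fix y :: 'a
    show "\<Phi> y * (?c * (\<integral>\<^sup>+t. \<Gamma> (2 *\<^sub>R t - y) \<partial>lborel)) = \<Phi> y * (\<integral>\<^sup>+x. \<Gamma> x \<partial>lborel)"
      using nn_integral_lborel_affine[of \<Gamma> 2 "- y"] by simp
  qed
  finally show ?thesis by (simp add: nn_integral_multc)
qed

text \<open>Each real component of the function is itself an admissible input of the isometric
  transform, and the four energies add up to the energy of the whole function.\<close>

lemma qolct_norm_nn_integral:
  assumes \<kappa>: "\<kappa>\<^sup>2 = -1" and \<mu>: "\<mu>\<^sup>2 = -1"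
    and A1: "pa A1 * pd A1 - pb A1 * pc A1 = 1" and A2: "pa A2 * pd A2 - pb A2 * pc A2 = 1"
    and m[measurable]: "h' \<in> borel_measurable (borel \<Otimes>\<^sub>M borel)"
    and eq: "AE s in lborel \<Otimes>\<^sub>M lborel. h s = h' s"
    and h: "(\<integral>\<^sup>+s. ennreal (norm (h' s)) \<partial>(lborel \<Otimes>\<^sub>M lborel)) < \<infinity>"
      "(\<integral>\<^sup>+s. ennreal ((norm (h' s))\<^sup>2) \<partial>(lborel \<Otimes>\<^sub>M lborel)) < \<infinity>"
  shows "(\<integral>\<^sup>+u. ennreal ((qolct_norm \<kappa> \<mu> A1 A2 h u)\<^sup>2) \<partial>(lborel \<Otimes>\<^sub>M lborel))
    = (\<integral>\<^sup>+s. ennreal ((norm (h' s))\<^sup>2) \<partial>(lborel \<Otimes>\<^sub>M lborel))"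
proof -
  let ?M = "lborel \<Otimes>\<^sub>M lborel :: (real \<times> real) measure"
  let ?q = "\<lambda>m. qolct \<kappa> \<mu> A1 A2 (\<lambda>s. of_real (m (h' s)))"
  \<comment> \<open>Components are bounded by the modulus, so they inherit integrability and square
    integrability.\<close>
  have le: "\<bar>m q\<bar> \<le> norm q" if "m \<in> {qRe, qI, qJ, qK}" for m q
    using that by (auto simp: norm_quat_def intro!: real_le_rsqrt)
  have comp: "(\<integral>\<^sup>+u. ennreal ((norm (?q m u))\<^sup>2) \<partial>?M) = (\<integral>\<^sup>+s. ennreal ((m (h' s))\<^sup>2) \<partial>?M)"
    "(\<lambda>u. ennreal ((norm (?q m u))\<^sup>2)) \<in> borel_measurable ?M"
    "AE u in ?M. qolct \<kappa> \<mu> A1 A2 (\<lambda>s. of_real (m (h s))) u = ?q m u"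
    if mem: "m \<in> {qRe, qI, qJ, qK}" for m
  proof -
    have [measurable]: "m \<in> borel_measurable borel" using mem by auto
    have mm: "(\<lambda>s. of_real (m (h' s)) :: quat) \<in> borel_measurable (borel \<Otimes>\<^sub>M borel)" by measurable
    have 1: "(\<integral>\<^sup>+s. ennreal (norm (of_real (m (h' s)) :: quat)) \<partial>?M) < \<infinity>"
      by (rule le_less_trans[OF nn_integral_mono h(1)]) (simp add: le[OF mem])
    have 2: "(\<integral>\<^sup>+s. ennreal ((norm (of_real (m (h' s)) :: quat))\<^sup>2) \<partial>?M) < \<infinity>"
      by (rule le_less_trans[OF nn_integral_mono h(2)]) (simp add: le[OF mem] abs_le_square_iff[symmetric])
    show "(\<integral>\<^sup>+u. ennreal ((norm (?q m u))\<^sup>2) \<partial>?M) = (\<integral>\<^sup>+s. ennreal ((m (h' s))\<^sup>2) \<partial>?M)"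
      using qolct_plancherel[OF \<kappa> \<mu> A1 A2 mm 1 2] by simp
    note [measurable] = borel_measurable_qolct[OF mm]
    show "(\<lambda>u. ennreal ((norm (?q m u))\<^sup>2)) \<in> borel_measurable ?M" by measurable
    show "AE u in ?M. qolct \<kappa> \<mu> A1 A2 (\<lambda>s. of_real (m (h s))) u = ?q m u"
      by (rule qolct_cong_AE[OF A1 A2 mm]) (use eq in eventually_elim, simp)
  qed
  have "(\<integral>\<^sup>+u. ennreal ((qolct_norm \<kappa> \<mu> A1 A2 h u)\<^sup>2) \<partial>?M)
    = (\<integral>\<^sup>+u. ennreal ((norm (?q qRe u))\<^sup>2) + (ennreal ((norm (?q qI u))\<^sup>2)
        + (ennreal ((norm (?q qJ u))\<^sup>2) + ennreal ((norm (?q qK u))\<^sup>2))) \<partial>?M)"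
  proof (rule nn_integral_cong_AE)
    show "AE u in ?M. ennreal ((qolct_norm \<kappa> \<mu> A1 A2 h u)\<^sup>2) = ennreal ((norm (?q qRe u))\<^sup>2) + (ennreal ((norm (?q qI u))\<^sup>2)
        + (ennreal ((norm (?q qJ u))\<^sup>2) + ennreal ((norm (?q qK u))\<^sup>2)))"
      using comp(3)[of qRe, simplified] comp(3)[of qI, simplified] comp(3)[of qJ, simplified] comp(3)[of qK, simplified]
      by eventually_elim (simp add: qolct_norm_def ennreal_plus[symmetric] del: ennreal_plus)
  qed
  also have "\<dots> = (\<integral>\<^sup>+s. ennreal ((qRe (h' s))\<^sup>2) + (ennreal ((qI (h' s))\<^sup>2)
      + (ennreal ((qJ (h' s))\<^sup>2) + ennreal ((qK (h' s))\<^sup>2))) \<partial>?M)"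
    using comp(1,2)[of qRe] comp(1,2)[of qI] comp(1,2)[of qJ] comp(1,2)[of qK]
    by (simp add: nn_integral_add)
  also have "\<dots> = (\<integral>\<^sup>+s. ennreal ((norm (h' s))\<^sup>2) \<partial>?M)"
    by (intro nn_integral_cong) (simp add: norm_quat_def ennreal_plus[symmetric] del: ennreal_plus)
  finally show ?thesis .
qed

theorem theorem4p5:
  fixes \<kappa> \<mu> :: quat
    and A1 A2 :: olct_params
    and f g :: "real \<times> real \<Rightarrow> quat"
  assumes "\<kappa>\<^sup>2 = -1" and "\<mu>\<^sup>2 = -1"
    and "pa A1 * pd A1 - pb A1 * pc A1 = 1"
    and "pa A2 * pd A2 - pb A2 * pc A2 = 1"
    and "f \<in> L2Q" and "g \<in> L2Q"
  shows "(wvd_norm2Q \<kappa> \<mu> A1 A2 f g)\<^sup>2 = (norm2Q f)\<^sup>2 * (norm2Q g)\<^sup>2"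
proof -
  obtain f' where f'[measurable]: "f' \<in> borel_measurable borel" and ff': "AE x in lborel. f x = f' x"
    using assms(5) lebesgue_measurable_quat_AE_borel[of f] by (auto simp: L2Q_def)
  obtain g' where g'[measurable]: "g' \<in> borel_measurable borel" and gg': "AE x in lborel. g x = g' x"
    using assms(6) lebesgue_measurable_quat_AE_borel[of g] by (auto simp: L2Q_def)
  let ?F = "\<integral>\<^sup>+x. ennreal ((norm (f' x))\<^sup>2) \<partial>lborel"
  let ?G = "\<integral>\<^sup>+x. ennreal ((norm (g' x))\<^sup>2) \<partial>lborel"
  have N: "(norm2Q f)\<^sup>2 = ?F" "(norm2Q g)\<^sup>2 = ?G"
    unfolding norm2Q_def esqrt_power2 nn_integral_completion
    by (rule nn_integral_cong_AE, use ff' gg' in \<open>eventually_elim, simp\<close>)+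
  have fin: "?F < \<infinity>" "?G < \<infinity>"
    using assms(5,6) unfolding N[symmetric] by (auto simp: L2Q_def power2_eq_square ennreal_mult_less_top)
  let ?h = "wvd_prod f' g'"
  have mh[measurable]: "(\<lambda>p. ?h (fst p) (snd p)) \<in> borel_measurable (borel \<Otimes>\<^sub>M borel)"
    unfolding wvd_prod_def by measurable
  have mh1: "?h t \<in> borel_measurable borel" for t
    unfolding wvd_prod_def by measurable
  have L2: "(\<integral>\<^sup>+t. \<integral>\<^sup>+s. ennreal ((norm (?h t s))\<^sup>2) \<partial>lborel \<partial>lborel) = ?F * ?G"
    using nn_integral_wigner_substitution[of "\<lambda>x. ennreal ((norm (f' x))\<^sup>2)" "\<lambda>x. ennreal ((norm (g' x))\<^sup>2)"]
    by (simp add: wvd_prod_def norm_mult power_mult_distrib ennreal_mult)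
  have am: "x * y \<le> x\<^sup>2 + y\<^sup>2" for x y :: real
    using sum_squares_bound[of x y] zero_le_power2[of x] zero_le_power2[of y] by linarith
  \<comment> \<open>At each fixed \<open>t\<close> a product of two square integrable functions is
    integrable in \<open>s\<close>, by x y \<le> x^2 + y^2 and affine substitutions.\<close>
  have L1: "(\<integral>\<^sup>+s. ennreal (norm (?h t s)) \<partial>lborel) < \<infinity>" for t
  proof -
    have half: "(\<integral>\<^sup>+s. \<Phi> (t + c *\<^sub>R s) \<partial>lborel) < \<infinity>"
      if [measurable]: "\<Phi> \<in> borel_measurable borel" and "(\<integral>\<^sup>+x. \<Phi> x \<partial>lborel) < \<infinity>" "c \<noteq> 0"
      for \<Phi> :: "real \<times> real \<Rightarrow> ennreal" and c
      using that(2,3) nn_integral_lborel_affine[OF that(1,3), of t] by (auto simp: ennreal_mult_less_top)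
    have "(\<integral>\<^sup>+s. ennreal (norm (?h t s)) \<partial>lborel)
      \<le> (\<integral>\<^sup>+s. ennreal ((norm (f' (t + (1/2) *\<^sub>R s)))\<^sup>2) + ennreal ((norm (g' (t + (-1/2) *\<^sub>R s)))\<^sup>2) \<partial>lborel)"
    proof (rule nn_integral_mono)
      fix s
      have "norm (?h t s) \<le> (norm (f' (t + (1/2) *\<^sub>R s)))\<^sup>2 + (norm (g' (t + (-1/2) *\<^sub>R s)))\<^sup>2"
        using am[of "norm (f' (t + (1/2) *\<^sub>R s))" "norm (g' (t + (-1/2) *\<^sub>R s))"]
        by (simp add: wvd_prod_def norm_mult inverse_eq_divide)
      then show "ennreal (norm (?h t s)) \<le> ennreal ((norm (f' (t + (1/2) *\<^sub>R s)))\<^sup>2) + ennreal ((norm (g' (t + (-1/2) *\<^sub>R s)))\<^sup>2)"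
        by (simp add: ennreal_plus[symmetric] ennreal_leI del: ennreal_plus)
    qed
    also have "\<dots> = (\<integral>\<^sup>+s. ennreal ((norm (f' (t + (1/2) *\<^sub>R s)))\<^sup>2) \<partial>lborel)
        + (\<integral>\<^sup>+s. ennreal ((norm (g' (t + (-1/2) *\<^sub>R s)))\<^sup>2) \<partial>lborel)"
      by (rule nn_integral_add) measurable
    also have "\<dots> < \<infinity>"
      using half[of "\<lambda>x. ennreal ((norm (f' x))\<^sup>2)" "1/2"] half[of "\<lambda>x. ennreal ((norm (g' x))\<^sup>2)" "-1/2"] fin
      by (simp add: ennreal_add_less_top)
    finally show ?thesis .
  qed
  \<comment> \<open>For fixed \<open>t\<close> both arguments are affine in \<open>s\<close>, with
    slopes 1/2 and - 1/2, so the exceptional null sets of \<open>f\<close> and \<open>g\<close> pull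
    back to null sets in \<open>s\<close>.\<close>
  have eq: "AE s in lborel. wvd_prod f g t s = ?h t s" for t
    using AE_lborel_affine[OF ff', of "1/2" t] AE_lborel_affine[OF gg', of "-1/2" t]
    by (auto simp: wvd_prod_def inverse_eq_divide)
  have "(\<integral>\<^sup>+p. ennreal ((norm (?h (fst p) (snd p)))\<^sup>2) \<partial>(lborel \<Otimes>\<^sub>M lborel)) = ?F * ?G"
    unfolding L2[symmetric] by (subst lborel.nn_integral_fst[symmetric]) simp_all
  also have "\<dots> < \<infinity>"
    using fin by (simp add: ennreal_mult_less_top)
  finally have "(\<integral>\<^sup>+p. ennreal ((norm (?h (fst p) (snd p)))\<^sup>2) \<partial>(lborel \<Otimes>\<^sub>M lborel)) < \<infinity>" .
  \<comment> \<open>Finiteness of the double integral yields square integrability in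
    \<open>s\<close> for almost every \<open>t\<close>; the isometry at these \<open>t\<close>
    determines the outer integral.\<close>
  then have "AE t in lborel. (\<integral>\<^sup>+s. ennreal ((norm (?h (fst (t, s)) (snd (t, s))))\<^sup>2) \<partial>lborel) < \<infinity>"
    by (rule AE_nn_integral_fst_finite[rotated]) measurable
  then have "AE t in lborel. (\<integral>\<^sup>+u. ennreal ((wvd_norm \<kappa> \<mu> A1 A2 f g t u)\<^sup>2) \<partial>lebesgue)
      = (\<integral>\<^sup>+s. ennreal ((norm (?h t s))\<^sup>2) \<partial>lborel)"
  proof eventually_elim
    case (elim t)
    show ?case
      using qolct_norm_nn_integral[OF assms(1-4), unfolded lborel_prod borel_prod, OF mh1 eq L1] elim
      by (simp add: wvd_norm_def nn_integral_completion)
  qed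
  then have "(wvd_norm2Q \<kappa> \<mu> A1 A2 f g)\<^sup>2 = (\<integral>\<^sup>+t. \<integral>\<^sup>+s. ennreal ((norm (?h t s))\<^sup>2) \<partial>lborel \<partial>lborel)"
    unfolding wvd_norm2Q_def esqrt_power2 nn_integral_completion by (rule nn_integral_cong_AE)
  then show ?thesis by (simp add: L2 N)
qed

end
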